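(* Let $H$ be a hexagonal system that has a perfect matching, and let $Af(H)=\max_M af(H,M)$, the maximum taken over all perfect matchings $M$ of $H$. Then for every perfect matching $M$ of $H$ with $af(H,M)=Af(H)$ or $af(H,M)=Af(H)-1$, we have $$af(H,M)=fr(H,M).$$
   Context: A hexagonal system is a 2-connected finite plane graph in which every interior face is bounded by a regular hexagon of side length one (equivalently, a cycle of the infinite hexagonal lattice together with its interior); its interior faces are called hexagons. A perfect matching $M$ of a graph $G$ is a set of edges covering every vertex exactly once. A cycle of $G$ is $M$-alternating if its edges lie alternately in $M$ and in $E(G)\setminus M$. A set $S\subseteq E(G)\setminus M$ is an anti-forcing set of $M$ if $G-S$ has $M$ as its unique perfect matching; the anti-forcing number $af(G,M)$ is the minimum size of an anti-forcing set of $M$. For a hexagonal system $H$ with perfect matching $M$, $fr(H,M)$ denotes the number of hexagons of $H$ that are $M$-alternating. *)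

theory Defs
  imports Main
begin

text \<open>Infinite hexagonal lattice in brick-wall coordinates: vertices are integer
points; horizontal edges between (i,j) and (i+1,j) always, vertical edges between
(i,j) and (i,j+1) iff i+j is even. Hexagons (faces) are indexed by cells (i,j) with
i+j even; the hexagon of cell (i,j) has the six vertices (i+a,j+b), a<3, b<2.\<close>

type_synonym vert = "int \<times> int"
type_synonym edge = "vert set"

definition cells :: "vert set" where
  "cells = {(i,j). even (i + j)}"

fun hex_edge :: "vert \<Rightarrow> nat \<Rightarrow> edge" where
  "hex_edge (i,j) k =
    (if k = 0 then {(i,j),(i+1,j)}
     else if k = 1 then {(i+1,j),(i+2,j)}
     else if k = 2 then {(i+2,j),(i+2,j+1)}
     else if k = 3 then {(i+2,j+1),(i+1,j+1)}
     else if k = 4 then {(i+1,j+1),(i,j+1)}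
     else {(i,j+1),(i,j)})"

definition hex_edges :: "vert \<Rightarrow> edge set" where
  "hex_edges c = hex_edge c ` {0..<6}"

definition hex_verts :: "vert \<Rightarrow> vert set" where
  "hex_verts c = \<Union> (hex_edges c)"

definition hex_adj :: "vert \<Rightarrow> vert \<Rightarrow> bool" where
  "hex_adj c d \<longleftrightarrow> c \<noteq> d \<and> hex_edges c \<inter> hex_edges d \<noteq> {}"

definition hex_connected :: "vert set \<Rightarrow> bool" where
  "hex_connected T \<longleftrightarrow>
     (\<forall>c\<in>T. \<forall>d\<in>T. (\<lambda>x y. x \<in> T \<and> y \<in> T \<and> hex_adj x y)\<^sup>*\<^sup>* c d)"

text \<open>A hexagonal system, given by its (finite, nonempty) set S of hexagons: the union
of the hexagons is a closed topological disk, i.e. S is connected via shared edges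
and the set of lattice hexagons not in S is connected too (no holes). This is exactly
a lattice cycle together with its interior.\<close>
definition hexagonal_system :: "vert set \<Rightarrow> bool" where
  "hexagonal_system S \<longleftrightarrow> finite S \<and> S \<noteq> {} \<and> S \<subseteq> cells \<and>
     hex_connected S \<and> hex_connected (cells - S)"

definition HV :: "vert set \<Rightarrow> vert set" where
  "HV S = \<Union> (hex_verts ` S)"

definition HE :: "vert set \<Rightarrow> edge set" where
  "HE S = \<Union> (hex_edges ` S)"

definition perfect_matching :: "vert set \<Rightarrow> edge set \<Rightarrow> edge set \<Rightarrow> bool" where
  "perfect_matching V E M \<longleftrightarrow> M \<subseteq> E \<and> (\<forall>v\<in>V. \<exists>!e. e \<in> M \<and> v \<in> e)"

definition anti_forcing_set :: "vert set \<Rightarrow> edge set \<Rightarrow> edge set \<Rightarrow> edge set \<Rightarrow> bool" where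
  "anti_forcing_set V E M A \<longleftrightarrow> A \<subseteq> E - M \<and>
     (\<forall>M'. perfect_matching V (E - A) M' \<longleftrightarrow> M' = M)"

definition af :: "vert set \<Rightarrow> edge set \<Rightarrow> nat" where
  "af S M = Min {card A | A. anti_forcing_set (HV S) (HE S) M A}"

definition Af :: "vert set \<Rightarrow> nat" where
  "Af S = Max {af S M | M. perfect_matching (HV S) (HE S) M}"

definition alternating_hex :: "edge set \<Rightarrow> vert \<Rightarrow> bool" where
  "alternating_hex M c \<longleftrightarrow>
     (\<forall>k<6. hex_edge c k \<in> M \<longleftrightarrow> hex_edge c ((k + 1) mod 6) \<notin> M)"

definition fr :: "vert set \<Rightarrow> edge set \<Rightarrow> nat" where
  "fr S M = card {c \<in> S. alternating_hex M c}"

end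

(* Matchings of the system are governed by the dual digraph whose arcs are the non-matching edges.
   An alternating cycle, or a disjoint union of them, is the boundary of a set X of hexagons all of
   whose boundary arcs point the same way, so anti-forcing sets are exactly the sets meeting every
   such dicut, and the Lucchesi-Younger theorem turns af into the maximum size of a family of disjoint
   dicuts; the alternating hexagons are the singleton dicuts.  Take a maximum disjoint family that is
   minimal for a strictly increasing concave function of the sizes; it is laminar.  If it has a
   member with at least two hexagons, let X be a smallest such member.  The hexagons of X at minimal
   height (in the sense of height functions of lozenge tilings) are alternating, belong to the
   family and have all their out-neighbours in X.  Rotating all of them at once trades X and some
   singletons K of the family for the singletons at the out-neighbours N, and the geometry of the
   triangular lattice gives |N| >= |K| + 3.  So some other matching has anti-forcing number at least
   af + 2, which is impossible if af is Af or Af - 1; hence every member is a singleton. *)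
theory Submission
  imports Defs
begin

section \<open>The Lucchesi-Younger theorem\<close>

text \<open>One inequality is immediate: an anti-forcing set needs a separate edge for each of
  several disjoint dicuts. The min-max theorem makes this bound attained, so an optimal family can
  be compared with the alternating hexagons. The dual orientation turns the three arcs at a lattice
  vertex into a directed triangle. A boundary through that vertex uses one entering and one leaving
  arc; hence unmatched boundary arcs pointing the same way amount to alternation. Hence also the
  height steps, -2 on matched and +1 on unmatched arcs, which sum to 0 around a vertex. The function
  of the sizes serves two ends. Concavity lets crossing members of one type be uncrossed;
  monotonicity means that a smaller dicut can replace a member only if it collides with another
  member, and this is what puts the lowest hexagons of X into the family. The obstacle to rotating
  is that the arcs into the lowest hexagons become unmatched, so other members may collide on them;
  all of these turn out to lie in K. The 3 pays for the loss of X and leaves a gain of 2, which the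
  case Af - 1 requires.\<close>

lemma card_same_parity_interval:
  fixes \<psi> :: "'i \<Rightarrow> int"
  assumes inj: "inj_on \<psi> A" and rng: "\<psi> ` A \<subseteq> {- int n..<int m}" and par: "\<And>i. i \<in> A \<Longrightarrow> even (\<psi> i + k) = q"
    and mn: "m + n \<le> 2 * c"
  shows "card A \<le> c"
proof -
  \<comment> \<open>From the left end, the interval splits into pairs of consecutive integers. A
    fixed parity allows one value per pair, and \<open>?g\<close> numbers the pairs.\<close>
  let ?g = "\<lambda>i. nat ((\<psi> i + int n) div 2)"
  have "inj_on ?g A"
  proof (rule inj_onI)
    fix i j assume ij: "i \<in> A" "j \<in> A" "?g i = ?g j"
    have "- int n \<le> \<psi> i" "- int n \<le> \<psi> j" using rng ij by auto
    moreover have "even (\<psi> i + k) = even (\<psi> j + k)" using par ij by simp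
    moreover have "nat ((\<psi> i + int n) div 2) = nat ((\<psi> j + int n) div 2)" using ij(3) .
    ultimately have "(\<psi> i + int n) div 2 = (\<psi> j + int n) div 2" "even (\<psi> i) = even (\<psi> j)"
      by (auto simp: pos_imp_zdiv_nonneg_iff eq_nat_nat_iff)
    then have "\<psi> i = \<psi> j" by presburger
    then show "i = j" using inj ij by (auto dest: inj_onD)
  qed
  moreover have "?g ` A \<subseteq> {..<c}"
  proof (rule image_subsetI)
    fix i assume "i \<in> A"
    then have "- int n \<le> \<psi> i" "\<psi> i < int m" using rng by auto
    then have "?g i < c" using mn by (simp add: nat_less_iff pos_imp_zdiv_nonneg_iff)
    then show "?g i \<in> {..<c}" by simp
  qed
  ultimately show ?thesis using card_inj_on_le[of ?g A "{..<c}"] by simp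
qed

lemma finite_linear_rank:
  fixes above :: "'i \<Rightarrow> 'i \<Rightarrow> bool"
  assumes fin: "finite A" and tr: "\<And>i j k. above i j \<Longrightarrow> above j k \<Longrightarrow> above i k"
    and irr: "\<And>i. \<not> above i i"
    and tot: "\<And>i j. i \<in> A \<Longrightarrow> j \<in> A \<Longrightarrow> i \<noteq> j \<Longrightarrow> above i j \<or> above j i"
  shows "inj_on (\<lambda>i. card {j\<in>A. above j i}) A" and "i \<in> A \<Longrightarrow> card {j\<in>A. above j i} < card A"
proof -
  have lt: "card {k\<in>A. above k i} < card {k\<in>A. above k j}" if "i \<in> A" "above i j" for i j
  proof (rule psubset_card_mono)
    show "finite {k\<in>A. above k j}" using fin by simp
    have "i \<in> {k\<in>A. above k j}" "i \<notin> {k\<in>A. above k i}" using that irr by auto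
    moreover have "{k\<in>A. above k i} \<subseteq> {k\<in>A. above k j}" using tr that(2) by blast
    ultimately show "{k\<in>A. above k i} \<subset> {k\<in>A. above k j}" by blast
  qed
  show "inj_on (\<lambda>i. card {j\<in>A. above j i}) A"
  proof (rule inj_onI, rule ccontr)
    fix i j assume ij: "i \<in> A" "j \<in> A" "card {k\<in>A. above k i} = card {k\<in>A. above k j}" "i \<noteq> j"
    then show False using tot[OF ij(1,2,4)] lt[of i j] lt[of j i] by linarith
  qed
  show "card {j\<in>A. above j i} < card A" if "i \<in> A"
  proof (rule psubset_card_mono[OF fin])
    show "{j\<in>A. above j i} \<subset> A" using that irr[of i] by blast
  qed
qed

locale dicuts =
  fixes E :: "'a set" and src tgt :: "'a \<Rightarrow> 'v" and S :: "'v set"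
  assumes finE: "finite E" and finS: "finite S"
begin

text \<open>The two values of the Boolean stand for sets without entering arcs and sets without leaving arcs.
  All of them avoid the vertices outside \<open>S\<close>, which play the part of a root, so that families can
  be made laminar and not merely cross-free.\<close>
definition closed :: "bool \<times> 'v set \<Rightarrow> bool" where
  "closed p \<longleftrightarrow> snd p \<subseteq> S \<and> snd p \<noteq> {} \<and>
     (\<forall>e\<in>E. if fst p then tgt e \<in> snd p \<longrightarrow> src e \<in> snd p else src e \<in> snd p \<longrightarrow> tgt e \<in> snd p)"

definition cut :: "'v set \<Rightarrow> 'a set" where
  "cut X = {e \<in> E. (src e \<in> X) \<noteq> (tgt e \<in> X)}"

definition packing :: "'i set \<Rightarrow> ('i \<Rightarrow> bool \<times> 'v set) \<Rightarrow> ('a \<Rightarrow> nat) \<Rightarrow> bool" where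
  "packing I f c \<longleftrightarrow> finite I \<and> (\<forall>i\<in>I. closed (f i)) \<and>
     (\<forall>e\<in>E. card {i\<in>I. e \<in> cut (snd (f i))} \<le> c e)"

definition has_packing :: "('a \<Rightarrow> nat) \<Rightarrow> nat \<Rightarrow> bool" where
  "has_packing c n \<longleftrightarrow> (\<exists>f. packing {..<n} f c)"

text \<open>Strictly increasing and strictly concave in the cardinality up to \<open>card S\<close>, so that every
  uncrossing step decreases it.\<close>
definition weight :: "'v set \<Rightarrow> nat" where
  "weight X = card X * (2 * card S + 1 - card X)"

definition minimal_packing_family :: "'i set \<Rightarrow> ('i \<Rightarrow> bool \<times> 'v set) \<Rightarrow> ('a \<Rightarrow> nat) \<Rightarrow> bool" where
  "minimal_packing_family I f c \<longleftrightarrow> packing I f c \<and>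
     (\<forall>f'. packing I f' c \<longrightarrow> (\<Sum>i\<in>I. weight (snd (f i))) \<le> (\<Sum>i\<in>I. weight (snd (f' i))))"

definition laminar :: "'i set \<Rightarrow> ('i \<Rightarrow> bool \<times> 'v set) \<Rightarrow> bool" where
  "laminar I f \<longleftrightarrow> (\<forall>i\<in>I. \<forall>j\<in>I. snd (f i) \<subseteq> snd (f j) \<or> snd (f j) \<subseteq> snd (f i) \<or>
     snd (f i) \<inter> snd (f j) = {})"

lemma fam_reindex:
  assumes f: "packing I f c" and b: "inj_on b J" "b ` J \<subseteq> I" and J: "finite J"
  shows "packing J (f \<circ> b) c"
proof -
  have "card {j\<in>J. e \<in> cut (snd ((f \<circ> b) j))} \<le> c e" if "e \<in> E" for e
  proof -
    have "card {j\<in>J. e \<in> cut (snd ((f \<circ> b) j))} = card (b ` {j\<in>J. e \<in> cut (snd ((f \<circ> b) j))})"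
      by (rule card_image[symmetric]) (use b in \<open>auto simp: inj_on_def\<close>)
    also have "\<dots> \<le> card {i\<in>I. e \<in> cut (snd (f i))}"
      by (rule card_mono) (use f b in \<open>auto simp: packing_def\<close>)
    also have "\<dots> \<le> c e" using f that by (auto simp: packing_def)
    finally show ?thesis .
  qed
  then show ?thesis using f b J by (auto simp: packing_def)
qed

lemma packsI:
  assumes f: "packing I f c" and n: "n \<le> card I"
  shows "has_packing c n"
proof -
  obtain I' where I': "I' \<subseteq> I" "card I' = n" "finite I'"
    using n by (meson obtain_subset_with_card_n)
  obtain b where "bij_betw b {..<n} I'"
    using ex_bij_betw_nat_finite[OF I'(3)] I'(2) by (auto simp: atLeast0LessThan)
  then have "packing {..<n} (f \<circ> b) c"
    using I' by (intro fam_reindex[OF f]) (auto simp: bij_betw_def)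
  then show ?thesis unfolding has_packing_def by blast
qed

lemma packs_mono: "has_packing c n \<Longrightarrow> m \<le> n \<Longrightarrow> has_packing c m"
  unfolding has_packing_def using packsI has_packing_def by (metis card_lessThan)

lemma packs_cap_mono:
  assumes "has_packing c n" "\<And>e. e \<in> E \<Longrightarrow> c e \<le> d e"
  shows "has_packing d n"
proof -
  obtain f where "packing {..<n} f c" using assms(1) by (auto simp: has_packing_def)
  then have "packing {..<n} f d" using assms(2) unfolding packing_def by (meson le_trans)
  then show ?thesis by (auto simp: has_packing_def)
qed

lemma packs_add:
  assumes "has_packing c m" "has_packing d n"
  shows "has_packing (\<lambda>e. c e + d e) (m + n)"
proof -
  obtain f g where f: "packing {..<m} f c" and g: "packing {..<n} g d"
    using assms by (auto simp: has_packing_def)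
  have "card {i \<in> {..<m} <+> {..<n}. e \<in> cut (snd (case_sum f g i))} \<le> c e + d e"
    if "e \<in> E" for e
  proof -
    have "{i \<in> {..<m} <+> {..<n}. e \<in> cut (snd (case_sum f g i))} =
       {i\<in>{..<m}. e \<in> cut (snd (f i))} <+> {i\<in>{..<n}. e \<in> cut (snd (g i))}"
      by auto
    then show ?thesis using f g that by (auto simp: packing_def card_Plus intro: add_mono)
  qed
  then have "packing ({..<m} <+> {..<n}) (case_sum f g) (\<lambda>e. c e + d e)"
    using f g by (auto simp: packing_def)
  then show ?thesis by (rule packsI) (simp add: card_Plus)
qed

lemma ex_minimal_fam:
  assumes "has_packing c n"
  shows "\<exists>f. minimal_packing_family {..<n} f c"
proof -
  obtain f where "packing {..<n} f c" using assms by (auto simp: has_packing_def)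
  from ex_has_least_nat[of "\<lambda>f. packing {..<n} f c", OF this, of "\<lambda>f. \<Sum>i<n. weight (snd (f i))"]
  show ?thesis unfolding minimal_packing_family_def by blast
qed

text \<open>Passing from size x to size x + 1 adds \<open>2 * (card S - x)\<close>, which is
  positive for all x below \<open>card S\<close>.\<close>

lemma weight_strict_mono:
  assumes "card X < card Y" "Y \<subseteq> S"
  shows "weight X < weight Y"
proof -
  have "card Y \<le> card S" using assms finS card_mono by blast
  then obtain k where k: "card S = card Y + k" by (metis le_add_diff_inverse)
  obtain d where d: "card Y = card X + Suc d" using assms(1) less_iff_Suc_add by auto
  show ?thesis unfolding weight_def k d by (simp add: algebra_simps)
qed

text \<open>The linear parts cancel, since intersection and union have the same total size as the
  two sets. The quadratic parts differ by twice the product of the sizes of the two differences,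
  both nonempty here.\<close>

lemma weight_uncross:
  assumes "X \<subseteq> S" "Y \<subseteq> S" "\<not> X \<subseteq> Y" "\<not> Y \<subseteq> X"
  shows "weight (X \<inter> Y) + weight (X \<union> Y) < weight X + weight Y"
proof -
  have fin: "finite X" "finite Y" using assms finS finite_subset by auto
  define u x y where "u = card (X \<inter> Y)" and "x = card (X - Y)" and "y = card (Y - X)"
  have x: "x > 0" and y: "y > 0" using assms(3,4) fin by (auto simp: x_def y_def card_gt_0_iff)
  have cX: "card X = u + x" unfolding u_def x_def
    using fin by (metis Int_Diff_disjoint Int_Diff_Un card_Un_disjoint finite_Diff finite_Int)
  have cY: "card Y = u + y" unfolding u_def y_def
    using fin by (metis Int_Diff_disjoint Int_Diff_Un Int_commute card_Un_disjoint finite_Diff finite_Int)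
  have cU: "card (X \<union> Y) = u + x + y"
    using card_Un_Int[OF fin] cX cY u_def by simp
  have "card (X \<union> Y) \<le> card S" using assms finS by (intro card_mono) auto
  then obtain k where k: "card S = u + x + y + k" using cU by (metis le_add_diff_inverse)
  have "u * (u + 2*x + 2*y + 2*k + 1) + (u + x + y) * (u + x + y + 2*k + 1)
     < (u + x) * (u + x + 2*y + 2*k + 1) + (u + y) * (u + 2*x + y + 2*k + 1)"
    using x y by (simp add: algebra_simps)
  then show ?thesis unfolding weight_def k cX cY cU u_def[symmetric]
    by (simp add: algebra_simps)
qed

lemma fam_update2:
  assumes f: "packing I f c" and ij: "i \<in> I" "j \<in> I" "i \<noteq> j"
    and cl: "closed P" "closed Q"
    and le: "\<And>e. e \<in> E \<Longrightarrow> of_bool (e \<in> cut (snd P)) + of_bool (e \<in> cut (snd Q))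
        \<le> (of_bool (e \<in> cut (snd (f i))) + of_bool (e \<in> cut (snd (f j))) :: nat)"
  shows "packing I (f(i := P, j := Q)) c"
proof -
  let ?f = "f(i := P, j := Q)"
  have fI: "finite I" using f by (simp add: packing_def)
  have eq: "card {k\<in>I. e \<in> cut (snd (g k))} = (\<Sum>k\<in>I-{i,j}. of_bool (e \<in> cut (snd (g k)))) +
     of_bool (e \<in> cut (snd (g i))) + of_bool (e \<in> cut (snd (g j)))" for e and g :: "_ \<Rightarrow> bool \<times> 'v set"
  proof -
    have "card {k\<in>I. e \<in> cut (snd (g k))} = (\<Sum>k\<in>I. of_bool (e \<in> cut (snd (g k))))"
      using fI by (simp add: of_bool_def sum.If_cases Int_def)
    also have "\<dots> = of_bool (e \<in> cut (snd (g i))) + (\<Sum>k\<in>I-{i}. of_bool (e \<in> cut (snd (g k))))"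
      using fI ij by (meson sum.remove)
    also have "(\<Sum>k\<in>I-{i}. of_bool (e \<in> cut (snd (g k)))) =
       of_bool (e \<in> cut (snd (g j))) + (\<Sum>k\<in>I-{i}-{j}. of_bool (e \<in> cut (snd (g k))) :: nat)"
      using fI ij by (intro sum.remove) auto
    finally show ?thesis by (simp add: Diff_insert2[symmetric] insert_commute)
  qed
  have "card {k\<in>I. e \<in> cut (snd (?f k))} \<le> c e" if e: "e \<in> E" for e
  proof -
    have s: "(\<Sum>k\<in>I-{i,j}. of_bool (e \<in> cut (snd (?f k))) :: nat) = (\<Sum>k\<in>I-{i,j}. of_bool (e \<in> cut (snd (f k))))"
      by (rule sum.cong) auto
    have "card {k\<in>I. e \<in> cut (snd (?f k))} \<le> card {k\<in>I. e \<in> cut (snd (f k))}"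
      unfolding eq s using le[OF e] ij(3) by simp
    then show ?thesis using f e unfolding packing_def by (meson le_trans)
  qed
  then show ?thesis using f cl unfolding packing_def by auto
qed

lemma sum_update2:
  assumes "finite I" "i \<in> I" "j \<in> I" "i \<noteq> j"
    and "w P + w Q < w (f i) + (w (f j) :: nat)"
  shows "(\<Sum>k\<in>I. w ((f(i := P, j := Q)) k)) < (\<Sum>k\<in>I. w (f k))"
proof -
  have eq: "(\<Sum>k\<in>I. w (g k)) = w (g i) + (w (g j) + (\<Sum>k\<in>I-{i}-{j}. w (g k)))" for g
    using assms by (metis finite_Diff insertE insert_Diff sum.remove)
  have "(\<Sum>k\<in>I-{i}-{j}. w ((f(i := P, j := Q)) k)) = (\<Sum>k\<in>I-{i}-{j}. w (f k))"
    by (rule sum.cong) auto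
  then show ?thesis unfolding eq using assms by simp
qed

lemma minimal_fam_laminar:
  assumes m: "minimal_packing_family I f c"
  shows "laminar I f"
  unfolding laminar_def
proof (intro ballI, rule ccontr)
  fix i j assume ij: "i \<in> I" "j \<in> I"
    and n: "\<not> (snd (f i) \<subseteq> snd (f j) \<or> snd (f j) \<subseteq> snd (f i) \<or> snd (f i) \<inter> snd (f j) = {})"
  have f: "packing I f c" using m by (simp add: minimal_packing_family_def)
  obtain s X t Y where fi: "f i = (s, X)" and fj: "f j = (t, Y)" by fastforce
  have cl: "closed (s, X)" "closed (t, Y)" using f ij fi fj by (auto simp: packing_def)
  have n: "\<not> X \<subseteq> Y" "\<not> Y \<subseteq> X" "X \<inter> Y \<noteq> {}" using n fi fj by auto
  have sub: "X \<subseteq> S" "Y \<subseteq> S" using cl by (auto simp: closed_def)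
  have neq: "i \<noteq> j" using n fi fj by auto
  \<comment> \<open>Intersection and union inherit a common type. For opposite types, the complement
    of one set behaves like the type of the other but contains the root; intersecting with it gives
    the differences, which keep their own types and stay inside \<open>S\<close>.\<close>
  define P where "P = (if s = t then (s, X \<inter> Y) else (s, X - Y))"
  define Q where "Q = (if s = t then (t, X \<union> Y) else (t, Y - X))"
  have clPQ: "closed P" "closed Q"
    using cl n unfolding P_def Q_def closed_def by (auto split: if_splits)
  have "packing I (f(i := P, j := Q)) c"
  proof (rule fam_update2[OF f ij neq clPQ])
    fix e assume "e \<in> E"
    then show "of_bool (e \<in> cut (snd P)) + of_bool (e \<in> cut (snd Q))
        \<le> (of_bool (e \<in> cut (snd (f i))) + of_bool (e \<in> cut (snd (f j))) :: nat)"
      using cl unfolding P_def Q_def fi fj closed_def cut_def by (auto split: if_splits)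
  qed
  moreover have "(\<Sum>k\<in>I. weight (snd ((f(i := P, j := Q)) k))) < (\<Sum>k\<in>I. weight (snd (f k)))"
  proof (rule sum_update2)
    show "finite I" using f by (simp add: packing_def)
    show "weight (snd P) + weight (snd Q) < weight (snd (f i)) + weight (snd (f j))"
    proof (cases "s = t")
      case True
      then show ?thesis using weight_uncross[OF sub n(1,2)] fi fj P_def Q_def by simp
    next
      case False
      have fin: "finite X" "finite Y" using sub finS finite_subset by auto
      have "weight (X - Y) < weight X" "weight (Y - X) < weight Y"
        by (rule weight_strict_mono[OF psubset_card_mono]; use fin n sub in auto)+
      then show ?thesis using False fi fj P_def Q_def by simp
    qed
  qed (use ij neq in auto)
  ultimately show False using m unfolding minimal_packing_family_def by (meson not_le)
qed

text \<open>Colour a member by the parity of its depth in the laminar forest, shifted by its type.  The members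
  cut by a fixed arc are two chains of consecutive depths, one of each type, whose outermost members
  have the same depth; hence the colours alternate along the concatenated chains.\<close>
lemma laminar_split:
  fixes I :: "nat set"
  assumes f: "packing I f (\<lambda>e. 2 * c e)" and lam: "laminar I f"
  shows "\<exists>col. \<forall>q. packing {i\<in>I. col i = (q::bool)} f c"
proof -
  have fI: "finite I" using f by (simp add: packing_def)
  \<comment> \<open>The same set may occur at several indices when capacities exceed 1; comparing
    indices breaks these ties, so that members through a common vertex are linearly ordered.\<close>
  define above where "above j i \<longleftrightarrow> snd (f i) \<subseteq> snd (f j) \<and> (snd (f j) \<subseteq> snd (f i) \<longrightarrow> j < i)" for i j
  define depth where "depth i = card {j\<in>I. above j i}" for i
  define col where "col i = even (int (depth i) + of_bool (\<not> fst (f i)))" for i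
  have tr: "above i k" if "above i j" "above j k" for i j k
    using that unfolding above_def by (meson less_trans order_trans)
  have irr: "\<not> above i i" for i by (auto simp: above_def)
  have half: "card {i\<in>{i\<in>I. col i = q}. e \<in> cut (snd (f i))} \<le> c e" if e: "e \<in> E" for q e
  proof -
    let ?u = "src e" and ?v = "tgt e"
    define P where "P = {i\<in>I. fst (f i) \<and> ?u \<in> snd (f i) \<and> ?v \<notin> snd (f i)}"
    define N where "N = {i\<in>I. \<not> fst (f i) \<and> ?v \<in> snd (f i) \<and> ?u \<notin> snd (f i)}"
    define D where "D = {j\<in>I. ?u \<in> snd (f j) \<and> ?v \<in> snd (f j)}"
    define rP where "rP i = card {j\<in>P. above j i}" for i
    define rN where "rN i = card {j\<in>N. above j i}" for i
    have fin: "finite P" "finite N" "finite D" using fI by (auto simp: P_def N_def D_def)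
    have clT: "?u \<in> snd (f i)" if "i \<in> I" "fst (f i)" "?v \<in> snd (f i)" for i
      using f that e by (auto simp: packing_def closed_def)
    have clF: "?v \<in> snd (f i)" if "i \<in> I" "\<not> fst (f i)" "?u \<in> snd (f i)" for i
      using f that e by (auto simp: packing_def closed_def)
    have cutI: "{i\<in>I. e \<in> cut (snd (f i))} = P \<union> N"
      using clT clF e unfolding P_def N_def cut_def by blast
    have PN: "P \<inter> N = {}" by (auto simp: P_def N_def)
    have load: "card P + card N \<le> 2 * c e"
      using f e cutI card_Un_disjoint[OF fin(1,2) PN] by (auto simp: packing_def)
    have nest: "snd (f i) \<subseteq> snd (f j) \<or> snd (f j) \<subseteq> snd (f i)"
      if "i \<in> I" "j \<in> I" "x \<in> snd (f i)" "x \<in> snd (f j)" for i j x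
      using lam that unfolding laminar_def by blast
    have totP: "above i j \<or> above j i" if "i \<in> P" "j \<in> P" "i \<noteq> j" for i j
      using nest[of i j ?u] that unfolding P_def above_def mem_Collect_eq by linarith
    have totN: "above i j \<or> above j i" if "i \<in> N" "j \<in> N" "i \<noteq> j" for i j
      using nest[of i j ?v] that unfolding N_def above_def mem_Collect_eq by linarith
    \<comment> \<open>A member around \<open>i\<close> contains \<open>?u\<close>. If it has the
      other type, it also contains \<open>?v\<close> and lies in \<open>D\<close>; otherwise it lies
      in \<open>D\<close> or in \<open>P\<close>. Conversely, members of \<open>D\<close> are nested
      with \<open>i\<close> and cannot be inside it, since \<open>?v\<close> is not.\<close>
    have upP: "{j\<in>I. above j i} = D \<union> {j\<in>P. above j i}" if i: "i \<in> P" for i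
    proof -
      have "j \<in> D \<or> j \<in> P" if "j \<in> I" "above j i" for j
        using clT[OF that(1)] clF[OF that(1)] i that unfolding D_def P_def above_def by blast
      moreover have "above j i" if "j \<in> D" for j
        using nest[of i j ?u] i that unfolding D_def P_def above_def by blast
      ultimately show ?thesis by (auto simp: D_def P_def)
    qed
    have upN: "{j\<in>I. above j i} = D \<union> {j\<in>N. above j i}" if i: "i \<in> N" for i
    proof -
      have "j \<in> D \<or> j \<in> N" if "j \<in> I" "above j i" for j
        using clT[OF that(1)] clF[OF that(1)] i that unfolding D_def N_def above_def by blast
      moreover have "above j i" if "j \<in> D" for j
        using nest[of i j ?v] i that unfolding D_def N_def above_def by blast
      ultimately show ?thesis by (auto simp: D_def N_def)
    qed
    have dP: "depth i = card D + rP i" if "i \<in> P" for i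
      unfolding depth_def upP[OF that] rP_def
      by (rule card_Un_disjoint) (use fI in \<open>auto simp: D_def P_def\<close>)
    have dN: "depth i = card D + rN i" if "i \<in> N" for i
      unfolding depth_def upN[OF that] rN_def
      by (rule card_Un_disjoint) (use fI in \<open>auto simp: D_def N_def\<close>)
    \<comment> \<open>Positions on the concatenated chains: \<open>P\<close> occupies 0, 1, ... and
      \<open>N\<close> occupies -1, -2, ..., each from the outermost member inwards. The shift by
      type in \<open>col\<close> makes the colour equal to the parity of position plus
      \<open>card D\<close> on both chains.\<close>
    define \<psi> where "\<psi> i = (if i \<in> P then int (rP i) else - 1 - int (rN i))" for i
    have rkP: "inj_on rP P" "\<And>i. i \<in> P \<Longrightarrow> rP i < card P"
      unfolding rP_def by (rule finite_linear_rank[OF fin(1) tr irr totP]; assumption)+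
    have rkN: "inj_on rN N" "\<And>i. i \<in> N \<Longrightarrow> rN i < card N"
      unfolding rN_def by (rule finite_linear_rank[OF fin(2) tr irr totN]; assumption)+
    have eq: "{i\<in>{i\<in>I. col i = q}. e \<in> cut (snd (f i))} = {i\<in>P \<union> N. col i = q}"
      using cutI by blast
    show ?thesis unfolding eq
    proof (rule card_same_parity_interval[where \<psi> = \<psi> and n = "card N" and m = "card P" and k = "int (card D)" and q = q])
      show "inj_on \<psi> {i\<in>P \<union> N. col i = q}"
        using rkP(1) rkN(1) by (auto simp: inj_on_def \<psi>_def)
      show "\<psi> ` {i\<in>P \<union> N. col i = q} \<subseteq> {- int (card N)..<int (card P)}"
        using rkP(2) rkN(2) by (force simp: \<psi>_def)
      show "card P + card N \<le> 2 * c e" by (rule load)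
      show "even (\<psi> i + int (card D)) = q" if "i \<in> {i\<in>P \<union> N. col i = q}" for i
      proof (cases "i \<in> P")
        case True
        then show ?thesis using that dP[OF True] by (auto simp: \<psi>_def col_def P_def add.commute)
      next
        case False
        then have "i \<in> N" using that by auto
        then show ?thesis using that False dN[OF \<open>i \<in> N\<close>] by (auto simp: \<psi>_def col_def N_def)
      qed
    qed
  qed
  show ?thesis
    by (rule exI[of _ col]) (use f half fI in \<open>auto simp: packing_def\<close>)
qed

text \<open>Each of the two colour classes of a laminar family fits into the halved capacity, and
  one class has more than half of an odd number of members.\<close>

lemma packs_halve:
  assumes "has_packing (\<lambda>e. 2 * c e) (2 * k + 1)"
  shows "has_packing c (k + 1)"
proof -
  obtain f where f: "minimal_packing_family {..<2*k+1} f (\<lambda>e. 2 * c e)"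
    using ex_minimal_fam[OF assms(1)] by blast
  then have "packing {..<2*k+1} f (\<lambda>e. 2 * c e)" by (simp add: minimal_packing_family_def)
  from laminar_split[OF this minimal_fam_laminar[OF f]]
  obtain col where col: "\<And>q. packing {i\<in>{..<2*k+1}. col i = (q::bool)} f c" by blast
  have "card {i\<in>{..<2*k+1}. col i = True} + card {i\<in>{..<2*k+1}. col i = False} = card {..<2*k+1}"
  proof (subst card_Un_disjoint[symmetric])
    show "card ({i\<in>{..<2*k+1}. col i = True} \<union> {i\<in>{..<2*k+1}. col i = False}) = card {..<2*k+1}"
      by (rule arg_cong[of _ _ card]) auto
  qed auto
  then have "k + 1 \<le> card {i\<in>{..<2*k+1}. col i = True} \<or> k + 1 \<le> card {i\<in>{..<2*k+1}. col i = False}"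
    unfolding card_lessThan by linarith
  then obtain q where "k + 1 \<le> card {i\<in>{..<2*k+1}. col i = q}" by blast
  then show ?thesis by (rule packsI[OF col])
qed

text \<open>Lovasz's argument: restrict to cuts inside a set \<open>A\<close> of arcs.  If forbidding some arc lowers the
  packing number, use induction.  Otherwise double the capacity on a maximal set of arcs that does not
  raise the packing number \<open>k\<close>; doubling one more arc and forbidding that arc give two packings of
  \<open>2k + 1\<close> cuts altogether, and halving them contradicts the choice of the set.\<close>
theorem Lucchesi_Younger:
  assumes ne: "\<And>p. closed p \<Longrightarrow> cut (snd p) \<noteq> {}"
  shows "\<exists>J\<subseteq>E. (\<forall>p. closed p \<longrightarrow> J \<inter> cut (snd p) \<noteq> {}) \<and> has_packing (\<lambda>_. 1) (card J)"
proof -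
  have main: "\<exists>J\<subseteq>A. (\<forall>p. closed p \<and> cut (snd p) \<subseteq> A \<longrightarrow> J \<inter> cut (snd p) \<noteq> {}) \<and>
      has_packing (\<lambda>e. of_bool (e \<in> A)) (card J)" if "A \<subseteq> E" for A
    using finite_subset[OF that finE] that
  proof (induction A rule: finite_psubset_induct)
    case (psubset A)
    \<comment> \<open>Every cut is nonempty, so one arc can be picked from each member; unit
      capacities inside \<open>A\<close> and zero outside make the picks distinct elements of
      \<open>A\<close>.\<close>
    have bound: "n \<le> card A" if n: "has_packing (\<lambda>e. of_bool (e \<in> A)) n" for n
    proof -
      obtain f where f: "packing {..<n} f (\<lambda>e. of_bool (e \<in> A))" using n by (auto simp: has_packing_def)
      have load: "card {i\<in>{..<n}. e \<in> cut (snd (f i))} \<le> of_bool (e \<in> A)" if "e \<in> E" for e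
        using f that by (auto simp: packing_def)
      have "\<forall>i\<in>{..<n}. \<exists>e. e \<in> cut (snd (f i))" using f ne by (fastforce simp: packing_def)
      then obtain g where g: "\<And>i. i < n \<Longrightarrow> g i \<in> cut (snd (f i))" by (metis lessThan_iff)
      have gE: "g i \<in> E" if "i < n" for i using g[OF that] by (simp add: cut_def)
      have "g i \<in> A" if "i < n" for i
      proof (rule ccontr)
        assume "g i \<notin> A"
        then have "{i'\<in>{..<n}. g i \<in> cut (snd (f i'))} = {}" using load[OF gE[OF that]] by simp
        then show False using g[OF that] that by auto
      qed
      moreover have "inj_on g {..<n}"
      proof (rule inj_onI)
        fix i j assume ij: "i \<in> {..<n}" "j \<in> {..<n}" "g i = g j"
        have "card {i'\<in>{..<n}. g i \<in> cut (snd (f i'))} \<le> Suc 0"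
          using load[OF gE[of i]] ij by (auto intro: order_trans)
        moreover have "i \<in> {i'\<in>{..<n}. g i \<in> cut (snd (f i'))}" "j \<in> {i'\<in>{..<n}. g i \<in> cut (snd (f i'))}"
          using ij g[of i] g[of j] by auto
        ultimately show "i = j" by (subst (asm) card_le_Suc0_iff_eq) auto
      qed
      ultimately show ?thesis using card_inj_on_le[of g "{..<n}" A] psubset.hyps(1) by auto
    qed
    have "has_packing (\<lambda>e. of_bool (e \<in> A)) 0" by (auto simp: has_packing_def packing_def)
    then obtain k where k: "has_packing (\<lambda>e. of_bool (e \<in> A)) k" and kmax: "\<And>n. has_packing (\<lambda>e. of_bool (e \<in> A)) n \<Longrightarrow> n \<le> k"
      using Nat.ex_has_greatest_nat[of "has_packing (\<lambda>e. of_bool (e \<in> A))" 0 "card A"] bound by blast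
    show ?case
    proof (cases "\<exists>a\<in>A. \<not> has_packing (\<lambda>e. of_bool (e \<in> A - {a})) k")
      case True
      then obtain a where a: "a \<in> A" and nk: "\<not> has_packing (\<lambda>e. of_bool (e \<in> A - {a})) k" by blast
      obtain J where J: "J \<subseteq> A - {a}"
        "\<And>p. closed p \<Longrightarrow> cut (snd p) \<subseteq> A - {a} \<Longrightarrow> J \<inter> cut (snd p) \<noteq> {}"
        "has_packing (\<lambda>e. of_bool (e \<in> A - {a})) (card J)"
        using psubset.IH[of "A - {a}"] a psubset.prems by blast
      \<comment> \<open>Any cut inside \<open>A\<close> either avoids \<open>a\<close> and is hit by
        \<open>J\<close>, or contains \<open>a\<close>. The one extra arc costs no more than the
        drop of the packing number.\<close>
      have "card J < k" using packs_mono[OF J(3)] nk not_le by blast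
      moreover have "card (insert a J) \<le> Suc (card J)" by (simp add: card_insert_le_m1 card_insert_if)
      ultimately have "has_packing (\<lambda>e. of_bool (e \<in> A)) (card (insert a J))"
        using packs_mono[OF k] by simp
      then show ?thesis using J a by (intro exI[of _ "insert a J"]) blast
    next
      case False
      then have del: "has_packing (\<lambda>e. of_bool (e \<in> A - {a})) k" if "a \<in> A" for a using that by blast
      have "k = 0"
      proof (rule ccontr)
        assume "k \<noteq> 0"
        define good where "good F \<longleftrightarrow> F \<subseteq> A \<and> \<not> has_packing (\<lambda>e. of_bool (e \<in> A) + of_bool (e \<in> F)) (k + 1)" for F
        have "has_packing (\<lambda>e. of_bool (e \<in> A) + of_bool (e \<in> A)) (k + 1)"
          using packs_mono[OF packs_add[OF k k]] \<open>k \<noteq> 0\<close> by simp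
        then have nA: "\<not> good A" by (auto simp: good_def)
        have "good {}" using kmax[of "k+1"] by (auto simp: good_def)
        moreover have "finite {F. good F}"
          using psubset.hyps(1) by (auto simp: good_def)
        ultimately obtain F where F: "good F" and Fmax: "\<And>F'. good F' \<Longrightarrow> F \<subseteq> F' \<Longrightarrow> F = F'"
          using finite_has_maximal[of "{F. good F}"] by blast
        have "F \<noteq> A" "F \<subseteq> A" using F nA by (auto simp: good_def)
        then obtain a where a: "a \<in> A" "a \<notin> F" by blast
        have "\<not> good (insert a F)" using Fmax[of "insert a F"] a by blast
        then have "has_packing (\<lambda>e. of_bool (e \<in> A) + of_bool (e \<in> insert a F)) (k + 1)"
          using F a by (auto simp: good_def)
        \<comment> \<open>The second packing avoids \<open>a\<close>, so at \<open>a\<close> the two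
          loads add up to at most 2, just the doubled original capacity there. Every other arc of
          \<open>A\<close> has at least one unit of capacity to spare for the second
          packing.\<close>
        from packs_add[OF this del[OF a(1)]]
        have "has_packing (\<lambda>e. 2 * (of_bool (e \<in> A) + of_bool (e \<in> F))) (k + 1 + k)"
          by (rule packs_cap_mono) (use F a in \<open>auto simp: good_def\<close>)
        then have "has_packing (\<lambda>e. 2 * (of_bool (e \<in> A) + of_bool (e \<in> F))) (2 * k + 1)"
          by (simp add: mult_2)
        then have "has_packing (\<lambda>e. of_bool (e \<in> A) + of_bool (e \<in> F)) (k + 1)"
          by (rule packs_halve)
        then show False using F by (simp add: good_def)
      qed
      have "\<not> (closed p \<and> cut (snd p) \<subseteq> A)" for p
      proof
        assume p: "closed p \<and> cut (snd p) \<subseteq> A"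
        have "card {i\<in>{..<Suc 0}. e \<in> cut (snd p)} \<le> of_bool (e \<in> A)" for e
          using p by (cases "e \<in> cut (snd p)") auto
        then have "packing {..<Suc 0} (\<lambda>_. p) (\<lambda>e. of_bool (e \<in> A))"
          using p unfolding packing_def by blast
        then have "has_packing (\<lambda>e. of_bool (e \<in> A)) 1" by (auto simp: has_packing_def)
        then show False using kmax \<open>k = 0\<close> by force
      qed
      then show ?thesis using k \<open>k = 0\<close> by (intro exI[of _ "{}"]) auto
    qed
  qed
  obtain J where J: "J \<subseteq> E" "\<And>p. closed p \<Longrightarrow> cut (snd p) \<subseteq> E \<Longrightarrow> J \<inter> cut (snd p) \<noteq> {}"
      "has_packing (\<lambda>e. of_bool (e \<in> E)) (card J)"
    using main[of E] by blast
  have "cut X \<subseteq> E" for X by (auto simp: cut_def)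
  then show ?thesis using J packs_cap_mono[OF J(3), of "\<lambda>_. 1"] by (intro exI[of _ J]) auto
qed

end

section \<open>The dual triangular lattice\<close>

text \<open>Every dual edge joins a cell to its translate by exactly one of these three vectors, whose sum is 0.
  The three cells at a lattice vertex therefore form a directed triangle.\<close>
definition dual_arc :: "vert \<Rightarrow> vert \<Rightarrow> bool" where
  "dual_arc x y \<longleftrightarrow> even (fst x + snd x) \<and>
     (y = (fst x - 1, snd x - 1) \<or> y = (fst x + 2, snd x) \<or> y = (fst x - 1, snd x + 1))"

text \<open>For adjacent cells the intersection consists of the two ends of their common lattice
  edge. Being symmetric, it names the same edge when the arc is reversed.\<close>

definition shared_edge :: "vert \<Rightarrow> vert \<Rightarrow> edge" where
  "shared_edge x y = hex_verts x \<inter> hex_verts y"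

definition dual_triangle :: "vert \<Rightarrow> vert \<Rightarrow> vert \<Rightarrow> bool" where
  "dual_triangle x y z \<longleftrightarrow> dual_arc x y \<and> dual_arc y z \<and> dual_arc z x"

lemma ed_commute: "shared_edge x y = shared_edge y x"
  by (auto simp: shared_edge_def)

lemma atLeast0LessThan_6: "{0..<6::nat} = {0,1,2,3,4,5}"
  by auto

lemma hex_edges_eq: "hex_edges (i,j) = {{(i,j+1),(i,j)}, {(i+1,j+1),(i,j+1)}, {(i+2,j+1),(i+1,j+1)},
    {(i+2,j),(i+2,j+1)}, {(i+1,j),(i+2,j)}, {(i,j),(i+1,j)}}"
proof -
  have "{0..<6::nat} = {5,4,3,2,1,0}" by auto
  then show ?thesis unfolding hex_edges_def by simp
qed

lemma hex_verts_iff: "(a,b) \<in> hex_verts (i,j) \<longleftrightarrow> i \<le> a \<and> a \<le> i + 2 \<and> j \<le> b \<and> b \<le> j + 1"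
proof -
  have "(a,b) \<in> hex_verts (i,j) \<longleftrightarrow> (a = i \<or> a = i + 1 \<or> a = i + 2) \<and> (b = j \<or> b = j + 1)"
    unfolding hex_verts_def hex_edges_eq by simp argo
  also have "\<dots> \<longleftrightarrow> i \<le> a \<and> a \<le> i + 2 \<and> j \<le> b \<and> b \<le> j + 1"
    by presburger
  finally show ?thesis .
qed

lemma ed_simps:
  "shared_edge (i,j) (i-1,j-1) = {(i,j),(i+1,j)}"
  "shared_edge (i,j) (i+2,j) = {(i+2,j),(i+2,j+1)}"
  "shared_edge (i,j) (i-1,j+1) = {(i,j+1),(i+1,j+1)}"
  unfolding shared_edge_def by (auto simp: hex_verts_iff)

lemma arr_cases:
  assumes "dual_arc x y"
  obtains i j where "even (i + j)" "x = (i,j)" "y = (i-1,j-1)"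
  | i j where "even (i + j)" "x = (i,j)" "y = (i+2,j)"
  | i j where "even (i + j)" "x = (i,j)" "y = (i-1,j+1)"
  using assms unfolding dual_arc_def by (cases x) auto

lemma arr_cells: "dual_arc x y \<Longrightarrow> x \<in> cells" "dual_arc x y \<Longrightarrow> y \<in> cells"
  unfolding dual_arc_def cells_def by (auto split: prod.splits)

lemma arr_asym: "dual_arc x y \<Longrightarrow> \<not> dual_arc y x"
  unfolding dual_arc_def by (cases x; cases y) auto

lemma arr_irrefl: "\<not> dual_arc x x"
  unfolding dual_arc_def by (cases x) auto

lemma ed_inj:
  assumes "dual_arc x y" "dual_arc x' y'" "shared_edge x y = shared_edge x' y'"
  shows "x = x' \<and> y = y'"
  using assms(1)
proof (cases rule: arr_cases)
  case (1 i j)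
  show ?thesis using assms(2)
    by (cases rule: arr_cases) (use 1 assms(3) in \<open>auto simp: ed_simps doubleton_eq_iff\<close>)
next
  case (2 i j)
  show ?thesis using assms(2)
    by (cases rule: arr_cases) (use 2 assms(3) in \<open>auto simp: ed_simps doubleton_eq_iff\<close>)
next
  case (3 i j)
  show ?thesis using assms(2)
    by (cases rule: arr_cases) (use 3 assms(3) in \<open>auto simp: ed_simps doubleton_eq_iff\<close>)
qed

text \<open>Around a hexagon the sides with even index are crossed by outgoing dual arcs and those
  with odd index by incoming ones. Alternation of a hexagon thereby becomes a statement about all
  in-arcs or all out-arcs.\<close>

lemma hex_edge_ed:
  assumes "even (i + j)"
  shows "hex_edge (i,j) 0 = shared_edge (i,j) (i-1,j-1)" "dual_arc (i,j) (i-1,j-1)"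
    "hex_edge (i,j) 1 = shared_edge (i+1,j-1) (i,j)" "dual_arc (i+1,j-1) (i,j)"
    "hex_edge (i,j) 2 = shared_edge (i,j) (i+2,j)" "dual_arc (i,j) (i+2,j)"
    "hex_edge (i,j) 3 = shared_edge (i+1,j+1) (i,j)" "dual_arc (i+1,j+1) (i,j)"
    "hex_edge (i,j) 4 = shared_edge (i,j) (i-1,j+1)" "dual_arc (i,j) (i-1,j+1)"
    "hex_edge (i,j) 5 = shared_edge (i-2,j) (i,j)" "dual_arc (i-2,j) (i,j)"
  using assms ed_simps(1)[of "i+1" "j+1"] ed_simps(2)[of "i-2" j] ed_simps(3)[of "i+1" "j-1"]
  by (auto simp: ed_simps(1)[of i j] ed_simps(2)[of i j] ed_simps(3)[of i j] dual_arc_def)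

lemma hex_edges_ed:
  assumes "x \<in> cells"
  shows "hex_edges x = {shared_edge x y | y. dual_arc x y \<or> dual_arc y x}"
proof -
  obtain i j where x: "x = (i,j)" and e: "even (i + j)" using assms by (auto simp: cells_def)
  have 1: "dual_arc x y \<longleftrightarrow> y = (i-1,j-1) \<or> y = (i+2,j) \<or> y = (i-1,j+1)" for y
    using x e by (auto simp: dual_arc_def)
  have 2: "dual_arc y x \<longleftrightarrow> y = (i+1,j-1) \<or> y = (i-2,j) \<or> y = (i+1,j+1)" for y
    using x e by (cases y) (auto simp: dual_arc_def)
  have "hex_edges x = {hex_edge x 0, hex_edge x 1, hex_edge x 2, hex_edge x 3, hex_edge x 4, hex_edge x 5}"
    unfolding hex_edges_def atLeast0LessThan_6 by simp
  also have "\<dots> = {shared_edge x (i-1,j-1), shared_edge x (i+1,j-1), shared_edge x (i+2,j), shared_edge x (i+1,j+1), shared_edge x (i-1,j+1), shared_edge x (i-2,j)}"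
    unfolding x using hex_edge_ed[OF e] ed_commute[of "(i,j)"] by metis
  also have "\<dots> = {shared_edge x y | y. dual_arc x y \<or> dual_arc y x}" unfolding 1 2 by blast
  finally show ?thesis .
qed

lemma HE_iff:
  assumes "S \<subseteq> cells"
  shows "e \<in> HE S \<longleftrightarrow> (\<exists>x y. dual_arc x y \<and> (x \<in> S \<or> y \<in> S) \<and> e = shared_edge x y)"
proof -
  have "e \<in> HE S \<longleftrightarrow> (\<exists>x\<in>S. \<exists>y. e = shared_edge x y \<and> (dual_arc x y \<or> dual_arc y x))"
  proof -
    have "e \<in> HE S \<longleftrightarrow> (\<exists>x\<in>S. e \<in> hex_edges x)" by (simp add: HE_def)
    also have "\<dots> \<longleftrightarrow> (\<exists>x\<in>S. e \<in> {shared_edge x y | y. dual_arc x y \<or> dual_arc y x})"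
      by (rule bex_cong[OF refl]) (use hex_edges_ed assms in blast)
    finally show ?thesis by simp
  qed
  also have "\<dots> \<longleftrightarrow> (\<exists>x y. dual_arc x y \<and> (x \<in> S \<or> y \<in> S) \<and> e = shared_edge x y)"
    (is "?l \<longleftrightarrow> ?r")
  proof
    assume ?l
    then obtain x y where "x \<in> S" "e = shared_edge x y" "dual_arc x y \<or> dual_arc y x" by blast
    then show ?r using ed_commute[of x y] by metis
  next
    assume ?r
    then obtain x y where xy: "dual_arc x y" "x \<in> S \<or> y \<in> S" "e = shared_edge x y" by blast
    then have "e = shared_edge y x" using ed_commute[of x y] by simp
    then show ?l using xy by blast
  qed
  finally show ?thesis .
qed

lemma ed_HE:
  assumes "S \<subseteq> cells" "dual_arc x y"
  shows "shared_edge x y \<in> HE S \<longleftrightarrow> x \<in> S \<or> y \<in> S"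
  unfolding HE_iff[OF assms(1)] using ed_inj[OF assms(2)] assms(2) by metis

definition triangle_at :: "vert \<Rightarrow> vert \<Rightarrow> vert \<Rightarrow> vert \<Rightarrow> bool" where
  "triangle_at v x y z \<longleftrightarrow> dual_triangle x y z \<and> (\<forall>c\<in>cells. v \<in> hex_verts c \<longleftrightarrow> c = x \<or> c = y \<or> c = z)"

lemma tri_at_even:
  assumes e: "even (i + j)"
  shows "triangle_at (i,j) (i-2,j) (i,j) (i-1,j-1)"
  unfolding triangle_at_def
proof (intro conjI ballI)
  show "dual_triangle (i-2,j) (i,j) (i-1,j-1)" using e by (auto simp: dual_triangle_def dual_arc_def)
  fix c assume "c \<in> cells"
  then obtain a b where c: "c = (a,b)" and p: "even (a + b)" by (auto simp: cells_def)
  have "a = i - 2 \<and> b = j \<or> a = i \<and> b = j \<or> a = i - 1 \<and> b = j - 1"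
    if "a \<le> i" "i \<le> a + 2" "b \<le> j" "j \<le> b + 1"
  proof -
    have "a = i - 2 \<or> a = i - 1 \<or> a = i" "b = j - 1 \<or> b = j" using that by linarith+
    then show ?thesis using e p by (elim disjE) simp_all
  qed
  then show "(i,j) \<in> hex_verts c \<longleftrightarrow> c = (i-2,j) \<or> c = (i,j) \<or> c = (i-1,j-1)"
    unfolding c hex_verts_iff by auto
qed

lemma tri_at_odd:
  assumes e: "odd (i + j)"
  shows "triangle_at (i,j) (i-2,j-1) (i,j-1) (i-1,j)"
  unfolding triangle_at_def
proof (intro conjI ballI)
  show "dual_triangle (i-2,j-1) (i,j-1) (i-1,j)" using e by (auto simp: dual_triangle_def dual_arc_def)
  fix c assume "c \<in> cells"
  then obtain a b where c: "c = (a,b)" and p: "even (a + b)" by (auto simp: cells_def)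
  have "a = i - 2 \<and> b = j - 1 \<or> a = i \<and> b = j - 1 \<or> a = i - 1 \<and> b = j"
    if "a \<le> i" "i \<le> a + 2" "b \<le> j" "j \<le> b + 1"
  proof -
    have "a = i - 2 \<or> a = i - 1 \<or> a = i" "b = j - 1 \<or> b = j" using that by linarith+
    then show ?thesis using e p by (elim disjE) simp_all
  qed
  then show "(i,j) \<in> hex_verts c \<longleftrightarrow> c = (i-2,j-1) \<or> c = (i,j-1) \<or> c = (i-1,j)"
    unfolding c hex_verts_iff by auto
qed

lemma ex_tri_at: "\<exists>x y z. triangle_at v x y z"
  using tri_at_even tri_at_odd by (cases v) blast

lemma tri_rotate: "dual_triangle x y z \<Longrightarrow> dual_triangle y z x"
  by (auto simp: dual_triangle_def)

lemma tri_at_rotate: "triangle_at v x y z \<Longrightarrow> triangle_at v y z x"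
  by (auto simp: triangle_at_def dual_triangle_def)

lemma tri_vertex:
  assumes "dual_triangle x y z"
  shows "\<exists>v. triangle_at v x y z"
proof -
  have level: "\<exists>v. triangle_at v x y z" if t: "dual_triangle x y z" and l: "snd x = snd y" for x y z
  proof -
    obtain i j where x: "x = (i,j)" by force
    have e: "even (i + j)" using t x by (simp add: dual_triangle_def dual_arc_def)
    have y: "y = (i+2,j)" using t l unfolding x by (cases y; cases z) (auto simp: dual_triangle_def dual_arc_def)
    have "dual_arc y z" "dual_arc z x" using t by (auto simp: dual_triangle_def)
    then have "z = (i+1,j-1) \<or> z = (i+1,j+1)" unfolding x y by (cases z) (auto simp: dual_arc_def)
    then show ?thesis
    proof
      assume "z = (i+1,j-1)"
      then have "triangle_at (i+2,j) x y z" using tri_at_even[of "i+2" j] e x y by (simp add: add.commute)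
      then show ?thesis ..
    next
      assume "z = (i+1,j+1)"
      then have "triangle_at (i+2,j+1) x y z" using tri_at_odd[of "i+2" "j+1"] e x y by (simp add: add.commute)
      then show ?thesis ..
    qed
  qed
  obtain i j where x: "x = (i,j)" by force
  have xy: "dual_arc x y" and yz: "dual_arc y z" and zx: "dual_arc z x" using assms by (auto simp: dual_triangle_def)
  have "snd x = snd y \<or> snd y = snd z \<or> snd z = snd x"
    using xy yz zx unfolding x by (cases y; cases z) (auto simp: dual_arc_def)
  then show ?thesis
  proof (elim disjE)
    assume "snd x = snd y"
    then show ?thesis using level assms by blast
  next
    assume "snd y = snd z"
    then obtain v where "triangle_at v y z x" using level tri_rotate[OF assms] by blast
    then show ?thesis using tri_at_rotate by blast
  next
    assume "snd z = snd x"
    then obtain v where "triangle_at v z x y" using level tri_rotate[OF tri_rotate[OF assms]] by blast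
    then show ?thesis using tri_at_rotate by blast
  qed
qed

lemma tri_ed_distinct:
  assumes "dual_triangle x y z"
  shows "shared_edge x y \<noteq> shared_edge y z" "shared_edge y z \<noteq> shared_edge z x" "shared_edge z x \<noteq> shared_edge x y"
  using assms ed_inj[of x y y z] ed_inj[of y z z x] ed_inj[of z x x y]
    arr_irrefl[of x] arr_irrefl[of y] arr_irrefl[of z]
  unfolding dual_triangle_def by blast+

text \<open>The three lattice edges at a vertex are crossed by the arcs of its dual triangle, and
  the vertex belongs to the system exactly when one of the three cells does. The integer sum allows
  two matchings to be subtracted.\<close>

lemma perfect_matching_iff:
  assumes S: "S \<subseteq> cells"
  shows "perfect_matching (HV S) (HE S) M \<longleftrightarrow> M \<subseteq> HE S \<and>
    (\<forall>x y z. dual_triangle x y z \<and> (x \<in> S \<or> y \<in> S \<or> z \<in> S) \<longrightarrow>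
       of_bool (shared_edge x y \<in> M) + of_bool (shared_edge y z \<in> M) + of_bool (shared_edge z x \<in> M) = (1::int))"
proof -
  have key: "(\<exists>!e. e \<in> M \<and> v \<in> e) \<longleftrightarrow>
       of_bool (shared_edge x y \<in> M) + of_bool (shared_edge y z \<in> M) + of_bool (shared_edge z x \<in> M) = (1::int)"
    if M: "M \<subseteq> HE S" and t: "triangle_at v x y z" for v x y z
  proof -
    have xyz: "dual_triangle x y z" and c: "\<And>c. c \<in> cells \<Longrightarrow> v \<in> hex_verts c \<longleftrightarrow> c = x \<or> c = y \<or> c = z"
      using t by (auto simp: triangle_at_def)
    have "e \<in> M \<and> v \<in> e \<longleftrightarrow> e \<in> M \<and> (e = shared_edge x y \<or> e = shared_edge y z \<or> e = shared_edge z x)" for e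
    proof
      assume e: "e \<in> M \<and> v \<in> e"
      then obtain p q where pq: "dual_arc p q" "e = shared_edge p q" using M HE_iff[OF S] by blast
      then have "v \<in> hex_verts p" "v \<in> hex_verts q" using e by (auto simp: shared_edge_def)
      then have "p = x \<or> p = y \<or> p = z" "q = x \<or> q = y \<or> q = z" using c arr_cells[OF pq(1)] by blast+
      then show "e \<in> M \<and> (e = shared_edge x y \<or> e = shared_edge y z \<or> e = shared_edge z x)"
        using pq e arr_irrefl by (metis ed_commute)
    next
      have "x \<in> cells" "y \<in> cells" "z \<in> cells" using xyz arr_cells unfolding dual_triangle_def by blast+
      then have "v \<in> shared_edge x y" "v \<in> shared_edge y z" "v \<in> shared_edge z x"
        using c[of x] c[of y] c[of z] by (auto simp: shared_edge_def)
      then show "e \<in> M \<and> v \<in> e" if "e \<in> M \<and> (e = shared_edge x y \<or> e = shared_edge y z \<or> e = shared_edge z x)"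
        using that by auto
    qed
    then show ?thesis using tri_ed_distinct[OF xyz] by (auto simp: of_bool_def)
  qed
  have HV: "v \<in> HV S \<longleftrightarrow> x \<in> S \<or> y \<in> S \<or> z \<in> S" if "triangle_at v x y z" for v x y z
  proof -
    have "x \<in> cells" "y \<in> cells" "z \<in> cells"
      using that arr_cells unfolding triangle_at_def dual_triangle_def by blast+
    then have "v \<in> hex_verts x" "v \<in> hex_verts y" "v \<in> hex_verts z"
      using that unfolding triangle_at_def by blast+
    moreover have "v \<in> HV S \<longleftrightarrow> (\<exists>c\<in>S. v \<in> hex_verts c)" by (simp add: HV_def)
    moreover have "c = x \<or> c = y \<or> c = z" if "c \<in> S" "v \<in> hex_verts c" for c
      using \<open>triangle_at v x y z\<close> S that unfolding triangle_at_def by blast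
    ultimately show ?thesis by metis
  qed
  have "(\<forall>v\<in>HV S. \<exists>!e. e \<in> M \<and> v \<in> e) \<longleftrightarrow>
    (\<forall>x y z. dual_triangle x y z \<and> (x \<in> S \<or> y \<in> S \<or> z \<in> S) \<longrightarrow>
       of_bool (shared_edge x y \<in> M) + of_bool (shared_edge y z \<in> M) + of_bool (shared_edge z x \<in> M) = (1::int))"
    (is "?l \<longleftrightarrow> ?r") if M: "M \<subseteq> HE S"
  proof
    assume l: ?l
    show ?r
    proof (intro allI impI, elim conjE)
      fix x y z assume xyz: "dual_triangle x y z" "x \<in> S \<or> y \<in> S \<or> z \<in> S"
      then obtain v where v: "triangle_at v x y z" using tri_vertex by blast
      then have "\<exists>!e. e \<in> M \<and> v \<in> e" using l HV xyz(2) by blast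
      then show "of_bool (shared_edge x y \<in> M) + of_bool (shared_edge y z \<in> M) + of_bool (shared_edge z x \<in> M) = (1::int)"
        using key[OF M v] by blast
    qed
  next
    assume r: ?r
    show ?l
    proof
      fix v assume v: "v \<in> HV S"
      obtain x y z where xyz: "triangle_at v x y z" using ex_tri_at by blast
      then have "x \<in> S \<or> y \<in> S \<or> z \<in> S" "dual_triangle x y z"
        using HV[OF xyz] v by (simp_all add: triangle_at_def)
      then show "\<exists>!e. e \<in> M \<and> v \<in> e" using key[OF M xyz] r by blast
    qed
  qed
  then show ?thesis unfolding perfect_matching_def by blast
qed

section \<open>Potentials and height functions\<close>

lemma tri_at_arcs:
  assumes t: "triangle_at v x y z" and a: "dual_arc p q"
  shows "v \<in> shared_edge p q \<longleftrightarrow> p = x \<and> q = y \<or> p = y \<and> q = z \<or> p = z \<and> q = x"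
proof -
  have xyz: "dual_arc x y" "dual_arc y z" "dual_arc z x" using t by (auto simp: triangle_at_def dual_triangle_def)
  have c: "v \<in> hex_verts c \<longleftrightarrow> c = x \<or> c = y \<or> c = z" if "c \<in> cells" for c
    using t that by (simp add: triangle_at_def)
  have pq: "p \<in> cells" "q \<in> cells" using arr_cells[OF a] .
  have "v \<in> shared_edge p q \<longleftrightarrow> (p = x \<or> p = y \<or> p = z) \<and> (q = x \<or> q = y \<or> q = z)"
    using c[OF pq(1)] c[OF pq(2)] by (simp add: shared_edge_def)
  then show ?thesis using a xyz arr_asym arr_irrefl by metis
qed

text \<open>The triangle around a vertex is unique up to rotation, so a cyclic sum depends on the
  vertex alone and can be evaluated on the explicit coordinates.\<close>

lemma tri_at_sum:
  fixes F :: "vert \<Rightarrow> vert \<Rightarrow> int"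
  assumes t: "triangle_at v x y z" and t': "triangle_at v x' y' z'"
  shows "F x y + F y z + F z x = F x' y' + F y' z' + F z' x'"
proof -
  have a: "dual_arc x y" "dual_arc y z" using t by (auto simp: triangle_at_def dual_triangle_def)
  have "v \<in> shared_edge x y" "v \<in> shared_edge y z" using tri_at_arcs[OF t] a by blast+
  then have "x = x' \<and> y = y' \<or> x = y' \<and> y = z' \<or> x = z' \<and> y = x'"
    "y = x' \<and> z = y' \<or> y = y' \<and> z = z' \<or> y = z' \<and> z = x'"
    using tri_at_arcs[OF t'] a by blast+
  moreover have "x' \<noteq> y'" "y' \<noteq> z'" "z' \<noteq> x'"
    using t' arr_irrefl unfolding triangle_at_def dual_triangle_def by metis+
  ultimately show ?thesis by auto
qed

text \<open>A discrete Poincare lemma: the potential is obtained by integrating along horizontal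
  rows from the far left, where the form vanishes.\<close>

lemma closed_form_exact:
  fixes W :: "vert \<Rightarrow> vert \<Rightarrow> int"
  assumes cl: "\<And>x y z. dual_triangle x y z \<Longrightarrow> W x y + W y z + W z x = 0"
    and far: "\<And>x y. dual_arc x y \<Longrightarrow> fst x < B \<Longrightarrow> W x y = 0"
  shows "\<exists>p. (\<forall>x y. dual_arc x y \<longrightarrow> W x y = p x - p y) \<and> (\<forall>x. fst x \<le> B \<longrightarrow> p x = 0)"
proof -
  \<comment> \<open>There are more terms than needed: the surplus arcs start left of
    \<open>B\<close> and contribute 0. The generous upper limit avoids a rounding by the step length
    2.\<close>
  define P where "P i j = (\<Sum>t<nat (i - B). W (i - 2 * int t - 2, j) (i - 2 * int t, j))" for i j
  have hor: "dual_arc (i-2,j) (i,j)" if "even (i + j)" for i j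
    using that by (auto simp: dual_arc_def)
  have rec: "P i j = P (i-2) j + W (i-2,j) (i,j)" if e: "even (i + j)" for i j
  proof (cases "i \<le> B + 1")
    case True
    show ?thesis
    proof (cases "i = B + 1")
      case True
      then show ?thesis by (simp add: P_def)
    next
      case False
      then show ?thesis using True far[OF hor[OF e]] by (simp add: P_def)
    qed
  next
    case False
    define n where "n = nat (i - 2 - B)"
    have n: "nat (i - B) = Suc (Suc n)" "int n = i - 2 - B" using False by (auto simp: n_def)
    have "P i j = W (i-2,j) (i,j) + (\<Sum>t<Suc n. W (i - 2 * int (Suc t) - 2, j) (i - 2 * int (Suc t), j))"
      unfolding P_def n by (subst sum.lessThan_Suc_shift) simp
    also have "(\<Sum>t<Suc n. W (i - 2 * int (Suc t) - 2, j) (i - 2 * int (Suc t), j)) =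
      (\<Sum>t<n. W (i - 2 * int (Suc t) - 2, j) (i - 2 * int (Suc t), j)) +
      W (i - 2 * int (Suc n) - 2, j) (i - 2 * int (Suc n), j)" by simp
    also have "W (i - 2 * int (Suc n) - 2, j) (i - 2 * int (Suc n), j) = 0"
    proof (rule far)
      show "dual_arc (i - 2 * int (Suc n) - 2, j) (i - 2 * int (Suc n), j)" using e by (auto simp: dual_arc_def)
      show "fst (i - 2 * int (Suc n) - 2, j) < B" using n False by simp
    qed
    also have "(\<Sum>t<n. W (i - 2 * int (Suc t) - 2, j) (i - 2 * int (Suc t), j)) = P (i-2) j"
      unfolding P_def n_def by (rule sum.cong) (auto simp: algebra_simps)
    finally show ?thesis by simp
  qed
  define p where "p x = - P (fst x) (snd x)" for x
  have pfar: "p x = 0" if "fst x \<le> B" for x using that by (simp add: p_def P_def)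
  have pb: "W (i-2,j) (i,j) = p (i-2,j) - p (i,j)" if "even (i + j)" for i j
    using rec[OF that] by (simp add: p_def)
  \<comment> \<open>\<open>A\<close> and \<open>C\<close> are the errors of the potential in the two
    slanted directions. The two triangles on a horizontal arc make \<open>A\<close> periodic along a
    row with period 2, so its vanishing on the far left kills it everywhere.\<close>
  define A where "A i j = W (i,j) (i-1,j-1) - (p (i,j) - p (i-1,j-1))" for i j
  define C where "C i j = W (i,j) (i-1,j+1) - (p (i,j) - p (i-1,j+1))" for i j
  have AC: "A i j = - C (i-1) (j-1)" if e: "even (i + j)" for i j
  proof -
    have "dual_triangle (i-2,j) (i,j) (i-1,j-1)" using tri_at_even[OF e] by (simp add: triangle_at_def)
    from cl[OF this] show ?thesis using pb[OF e] by (simp add: A_def C_def)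
  qed
  have CA: "C i j = - A (i-1) (j+1)" if e: "even (i + j)" for i j
  proof -
    have "dual_triangle (i-2,j) (i,j) (i-1,j+1)" using tri_at_odd[of i "j+1"] e by (simp add: triangle_at_def)
    from cl[OF this] show ?thesis using pb[OF e] by (simp add: A_def C_def)
  qed
  have A2: "A i j = A (i-2) j" if "even (i + j)" for i j
    using AC[OF that] CA[of "i-1" "j-1"] that by simp
  have An: "A i j = A (i - 2 * int n) j" if e: "even (i + j)" for i j n
  proof (induction n)
    case (Suc n)
    have "A (i - 2 * int n) j = A (i - 2 * int n - 2) j" by (rule A2) (use e in simp)
    then show ?case using Suc by (simp add: algebra_simps)
  qed simp
  have A0: "A i j = 0" if e: "even (i + j)" for i j
  proof -
    define n where "n = nat (\<bar>i\<bar> + \<bar>B\<bar> + 1)"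
    have l: "i - 2 * int n < B" by (simp add: n_def)
    have "dual_arc (i - 2 * int n, j) (i - 2 * int n - 1, j - 1)" using e by (auto simp: dual_arc_def)
    from far[OF this] have "A (i - 2 * int n) j = 0" using l pfar by (simp add: A_def)
    then show ?thesis using An[OF e, of n] by simp
  qed
  have C0: "C i j = 0" if e: "even (i + j)" for i j
    using CA[OF e] A0[of "i-1" "j+1"] e by simp
  have "W x y = p x - p y" if "dual_arc x y" for x y
    using that
  proof (cases rule: arr_cases)
    case (1 i j)
    then show ?thesis using A0[of i j] by (simp add: A_def)
  next
    case (2 i j)
    then show ?thesis using pb[of "i+2" j] by simp
  next
    case (3 i j)
    then show ?thesis using C0[of i j] by (simp add: C_def)
  qed
  then show ?thesis using pfar by blast
qed

lemma hex_adj_arr: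
  assumes "c \<in> cells" "d \<in> cells" "hex_adj c d"
  shows "dual_arc c d \<or> dual_arc d c"
proof -
  obtain e where e: "e \<in> hex_edges c" "e \<in> hex_edges d" and ne: "c \<noteq> d"
    using assms(3) by (auto simp: hex_adj_def)
  obtain y where y: "dual_arc c y \<or> dual_arc y c" "e = shared_edge c y"
    using e(1) unfolding hex_edges_ed[OF assms(1)] by blast
  obtain z where z: "dual_arc d z \<or> dual_arc z d" "e = shared_edge d z"
    using e(2) unfolding hex_edges_ed[OF assms(2)] by blast
  have "shared_edge c y = shared_edge d z" "shared_edge c y = shared_edge z d" "shared_edge y c = shared_edge d z" "shared_edge y c = shared_edge z d"
    using y(2) z(2) ed_commute by metis+
  then show ?thesis
    using y(1) z(1) ne ed_inj[of c y d z] ed_inj[of c y z d] ed_inj[of y c d z] ed_inj[of y c z d] by metis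
qed

lemma finite_fst_bounds:
  assumes "finite (S :: vert set)"
  obtains B where "\<And>x. x \<in> S \<Longrightarrow> \<bar>fst x\<bar> \<le> B"
proof -
  have "\<bar>fst x\<bar> \<le> (\<Sum>x\<in>S. \<bar>fst x\<bar>)" if "x \<in> S" for x
    using member_le_sum[of x S "\<lambda>x. \<bar>fst x\<bar>"] assms that by simp
  then show ?thesis using that by blast
qed

lemma arr_fst: "dual_arc x y \<Longrightarrow> fst y \<le> fst x + 2"
  by (auto simp: dual_arc_def)

text \<open>Propagation through the complement, which is where the absence of holes enters.\<close>

lemma complement_const:
  assumes "hex_connected (cells - S)" "c \<in> cells - S" "d \<in> cells - S"
    and "P c" "\<And>x y. x \<in> cells - S \<Longrightarrow> y \<in> cells - S \<Longrightarrow> dual_arc x y \<or> dual_arc y x \<Longrightarrow> P x \<Longrightarrow> P y"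
  shows "P d"
proof -
  have "(\<lambda>x y. x \<in> cells - S \<and> y \<in> cells - S \<and> hex_adj x y)\<^sup>*\<^sup>* c d"
    using assms(1-3) by (auto simp: hex_connected_def)
  then show ?thesis using assms(4)
  proof (induction rule: rtranclp_induct)
    case (step y z)
    then show ?case using assms(5)[of y z] hex_adj_arr by blast
  qed
qed

lemma matching_tri:
  assumes "S \<subseteq> cells" "perfect_matching (HV S) (HE S) M" "dual_triangle x y z"
  shows "of_bool (shared_edge x y \<in> M) + of_bool (shared_edge y z \<in> M) + of_bool (shared_edge z x \<in> M) =
    (of_bool (x \<in> S \<or> y \<in> S \<or> z \<in> S) :: int)"
proof (cases "x \<in> S \<or> y \<in> S \<or> z \<in> S")
  case True
  then have "of_bool (shared_edge x y \<in> M) + of_bool (shared_edge y z \<in> M) + of_bool (shared_edge z x \<in> M) = (1::int)"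
    using assms(2,3) unfolding perfect_matching_iff[OF assms(1)] by blast
  then show ?thesis using True by simp
next
  case False
  have "M \<subseteq> HE S" using assms(2) by (simp add: perfect_matching_def)
  moreover have "shared_edge x y \<notin> HE S" "shared_edge y z \<notin> HE S" "shared_edge z x \<notin> HE S"
    using ed_HE[OF assms(1)] assms(3) False by (simp_all add: dual_triangle_def)
  ultimately show ?thesis using False by auto
qed

text \<open>Both matchings have the same sum on every dual triangle, so their difference is closed
  and has a potential. It does not change between cells outside \<open>S\<close>, where no matching
  edge is crossed, and it is 0 far to the left.\<close>

lemma matching_potential:
  assumes S: "S \<subseteq> cells" "finite S" "hex_connected (cells - S)"
    and M: "perfect_matching (HV S) (HE S) M" "perfect_matching (HV S) (HE S) M'"
  shows "\<exists>p :: vert \<Rightarrow> int.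
    (\<forall>x y. dual_arc x y \<longrightarrow> of_bool (shared_edge x y \<in> M') - of_bool (shared_edge x y \<in> M) = p x - p y) \<and>
    (\<forall>x. x \<in> cells \<longrightarrow> x \<notin> S \<longrightarrow> p x = 0)"
proof -
  obtain B where B: "\<And>x. x \<in> S \<Longrightarrow> \<bar>fst x\<bar> \<le> B" using finite_fst_bounds[OF S(2)] by blast
  define W where "W x y = (of_bool (shared_edge x y \<in> M') - of_bool (shared_edge x y \<in> M) :: int)" for x y
  have sub: "M \<subseteq> HE S" "M' \<subseteq> HE S" using M by (auto simp: perfect_matching_def)
  have W0: "W x y = 0" if "dual_arc x y" "x \<notin> S" "y \<notin> S" for x y
    using sub ed_HE[OF S(1) that(1)] that by (auto simp: W_def)
  have cl: "W x y + W y z + W z x = 0" if "dual_triangle x y z" for x y z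
    using matching_tri[OF S(1) M(1) that] matching_tri[OF S(1) M(2) that] by (simp add: W_def)
  have far: "W x y = 0" if "dual_arc x y" "fst x < - B - 2" for x y
    using W0[OF that(1)] B[of x] B[of y] arr_fst[OF that(1)] that(2) by force
  obtain p where p: "\<And>x y. dual_arc x y \<Longrightarrow> W x y = p x - p y" "\<And>x. fst x \<le> - B - 2 \<Longrightarrow> p x = 0"
    using closed_form_exact[of W "- B - 2", OF cl far] by blast
  define c where "c = (- 2 * \<bar>B\<bar> - 4, 0 :: int)"
  have c: "c \<in> cells - S" "p c = 0" using B[of c] p(2)[of c] by (auto simp: c_def cells_def)
  have "p x = 0" if x: "x \<in> cells" "x \<notin> S" for x
  proof (rule complement_const[OF S(3) c(1), where P = "\<lambda>x. p x = 0"])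
    show "x \<in> cells - S" using x by simp
    show "p c = 0" by fact
    show "p z = 0" if "y \<in> cells - S" "z \<in> cells - S" "dual_arc y z \<or> dual_arc z y" "p y = 0" for y z
      using that W0[of y z] W0[of z y] p(1)[of y z] p(1)[of z y] by auto
  qed
  then show ?thesis using p(1) unfolding W_def by blast
qed

text \<open>A unit of divergence at \<open>v\<close> can be removed by a flow escaping to the right that only uses lattice
  edges on the boundary or outside of the system; this makes the local height differences closed on
  the whole lattice without changing them between cells of \<open>S\<close>.\<close>
definition drainable :: "vert set \<Rightarrow> vert \<Rightarrow> bool" where
  "drainable S v \<longleftrightarrow> (\<exists>\<phi> :: vert \<Rightarrow> vert \<Rightarrow> int.
     (\<forall>x y. x \<in> S \<and> y \<in> S \<longrightarrow> \<phi> x y = 0) \<and>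
     (\<exists>B. \<forall>x y. fst x < B \<longrightarrow> \<phi> x y = 0) \<and>
     (\<forall>u x y z. triangle_at u x y z \<longrightarrow> \<phi> x y + \<phi> y z + \<phi> z x = of_bool (u = v)))"

text \<open>A unit on a single arc has divergence +1 at both ends of the crossed edge. Subtracting
  the flow for \<open>u\<close> leaves divergence only at \<open>v\<close>; the change of sign
  reflects that the lattice is bipartite.\<close>

lemma drainable_edge:
  assumes d: "drainable S u" and a: "dual_arc x y" "\<not> (x \<in> S \<and> y \<in> S)" and e: "shared_edge x y = {u, v}" "u \<noteq> v"
  shows "drainable S v"
proof -
  obtain \<phi> B where \<phi>: "\<And>x y. x \<in> S \<and> y \<in> S \<Longrightarrow> \<phi> x y = (0::int)" "\<And>x y. fst x < B \<Longrightarrow> \<phi> x y = 0"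
    "\<And>w x y z. triangle_at w x y z \<Longrightarrow> \<phi> x y + \<phi> y z + \<phi> z x = of_bool (w = u)"
    using d unfolding drainable_def by blast
  define \<psi> where "\<psi> p q = of_bool (p = x \<and> q = y) - \<phi> p q" for p q
  have 1: "\<psi> p q = 0" if "p \<in> S \<and> q \<in> S" for p q using that \<phi>(1)[OF that] a(2) by (auto simp: \<psi>_def)
  have 2: "\<psi> p q = 0" if "fst p < min B (fst x)" for p q using that \<phi>(2)[of p q] by (auto simp: \<psi>_def)
  have 3: "\<psi> p q + \<psi> q r + \<psi> r p = of_bool (w = v)" if t: "triangle_at w p q r" for w p q r
  proof -
    have pqr: "dual_arc p q" "dual_arc q r" "dual_arc r p" using t by (auto simp: triangle_at_def dual_triangle_def)
    have "of_bool (p = x \<and> q = y) + of_bool (q = x \<and> r = y) + of_bool (r = x \<and> p = y) =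
       (of_bool (w \<in> shared_edge x y) :: int)"
    proof -
      have "p \<noteq> q" "q \<noteq> r" "r \<noteq> p" using pqr arr_irrefl by metis+
      then show ?thesis unfolding tri_at_arcs[OF t a(1)] by (auto simp: of_bool_def)
    qed
    also have "\<dots> = of_bool (w = u) + of_bool (w = v)" using e by auto
    finally show ?thesis using \<phi>(3)[OF t] by (simp add: \<psi>_def)
  qed
  show ?thesis unfolding drainable_def
    by (rule exI[of _ \<psi>]) (use 1 2 3 in blast)
qed

lemma drainable_cell:
  assumes c: "c \<in> cells" "c \<notin> S" and u: "u \<in> hex_verts c" "drainable S u" and v: "v \<in> hex_verts c"
  shows "drainable S v"
proof -
  have step: "drainable S p \<longleftrightarrow> drainable S q" if e: "{p, q} \<in> hex_edges c" "p \<noteq> q" for p q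
  proof -
    obtain y where y: "dual_arc c y \<or> dual_arc y c" "{p, q} = shared_edge c y"
      using e(1) unfolding hex_edges_ed[OF c(1)] by blast
    have "\<exists>x z. dual_arc x z \<and> \<not> (x \<in> S \<and> z \<in> S) \<and> shared_edge x z = {p, q}"
      using y(1)
    proof
      assume "dual_arc c y" then show ?thesis using c(2) y(2) by metis
    next
      assume "dual_arc y c" then show ?thesis using c(2) y(2) ed_commute by metis
    qed
    then obtain x z where xz: "dual_arc x z" "\<not> (x \<in> S \<and> z \<in> S)" "shared_edge x z = {p, q}" by blast
    then have "shared_edge x z = {q, p}" by blast
    then show ?thesis using drainable_edge[OF _ xz(1,2)] xz(3) e(2) by blast
  qed
  obtain i j where ij: "c = (i, j)" by force
  have "drainable S (i,j+1) \<longleftrightarrow> drainable S (i,j)"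
    "drainable S (i+1,j+1) \<longleftrightarrow> drainable S (i,j+1)"
    "drainable S (i+2,j+1) \<longleftrightarrow> drainable S (i+1,j+1)"
    "drainable S (i+1,j) \<longleftrightarrow> drainable S (i+2,j)"
    "drainable S (i,j) \<longleftrightarrow> drainable S (i+1,j)"
    by (rule step; simp add: ij hex_edges_eq)+
  moreover have "w \<in> {(i,j), (i+1,j), (i+2,j), (i,j+1), (i+1,j+1), (i+2,j+1)}" if "w \<in> hex_verts c" for w
    using that unfolding ij hex_verts_def hex_edges_eq by auto
  ultimately show ?thesis using u v by (metis empty_iff insert_iff)
qed

lemma drainable_far:
  assumes S: "\<And>x. x \<in> S \<Longrightarrow> fst x < i" and i: "even i"
  shows "drainable S (i, 0)"
proof -
  \<comment> \<open>The flow runs right along the lattice path between cell rows 0 and -1, with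
    alternating signs since consecutive dual arcs point down and up. At interior vertices of the
    path they cancel; with \<open>i\<close> even the first arc points down, so the end has
    divergence +1.\<close>
  define \<phi> :: "vert \<Rightarrow> vert \<Rightarrow> int" where "\<phi> x y = (if snd x = 0 \<and> snd y = -1 \<and> i \<le> fst x then 1
    else if snd x = -1 \<and> snd y = 0 \<and> i \<le> fst x then -1 else 0)" for x y
  have sum: "\<phi> x y + \<phi> y z + \<phi> z x = of_bool ((k,l) = (i,0))" if t: "triangle_at (k,l) x y z" for k l x y z
  proof (cases "even (k + l)")
    case True
    have "k = i + 1 \<longrightarrow> l \<noteq> 0" using True i by presburger
    then show ?thesis unfolding tri_at_sum[OF t tri_at_even[OF True]] using True by (auto simp: \<phi>_def)
  next
    case False
    have "k = i \<longrightarrow> l \<noteq> 0" using False i by presburger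
    then show ?thesis unfolding tri_at_sum[OF t tri_at_odd[OF False]] using False by (auto simp: \<phi>_def)
  qed
  have "\<phi> x y = 0" if "x \<in> S \<and> y \<in> S" for x y using that S[of x] by (auto simp: \<phi>_def)
  moreover have "\<phi> x y = 0" if "fst x < i" for x y using that by (auto simp: \<phi>_def)
  moreover have "\<phi> x y + \<phi> y z + \<phi> z x = of_bool (u = (i,0))" if "triangle_at u x y z" for u x y z
    using sum[of "fst u" "snd u"] that by simp
  ultimately show ?thesis unfolding drainable_def by blast
qed

lemma drainable_outside:
  assumes S: "finite S" "hex_connected (cells - S)" and c: "c \<in> cells" "c \<notin> S" "v \<in> hex_verts c"
  shows "drainable S v"
proof -
  obtain B where B: "\<And>x. x \<in> S \<Longrightarrow> \<bar>fst x\<bar> \<le> B" using finite_fst_bounds[OF S(1)] by blast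
  define i where "i = 2 * \<bar>B\<bar> + 2"
  have lt: "fst x < i" if "x \<in> S" for x using B[OF that] by (simp add: i_def)
  have d: "drainable S (i,0)" by (rule drainable_far[OF lt]) (auto simp: i_def)
  have c0: "(i,0) \<in> cells - S" using lt[of "(i,0)"] by (auto simp: cells_def i_def)
  have "\<forall>v\<in>hex_verts c. drainable S v"
  proof (rule complement_const[OF S(2) c0, where P = "\<lambda>c. \<forall>v\<in>hex_verts c. drainable S v"])
    show "c \<in> cells - S" using c by simp
    show "\<forall>v\<in>hex_verts (i,0). drainable S v"
      using drainable_cell[of "(i,0)" S "(i,0)"] c0 d by (auto simp: hex_verts_iff)
    show "\<forall>v\<in>hex_verts z. drainable S v"
      if "y \<in> cells - S" "z \<in> cells - S" "dual_arc y z \<or> dual_arc z y" "\<forall>v\<in>hex_verts y. drainable S v" for y z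
    proof -
      have ne: "shared_edge p q \<noteq> {}" if "dual_arc p q" for p q
        using that by (cases rule: arr_cases) (auto simp: ed_simps)
      have "hex_verts y \<inter> hex_verts z \<noteq> {}"
        using that(3) ne[of y z] ne[of z y] unfolding shared_edge_def by blast
      then show ?thesis using drainable_cell[of z S] that by blast
    qed
  qed
  then show ?thesis using c(3) by blast
qed

lemma finite_HV: "finite S \<Longrightarrow> finite (HV S)"
proof -
  have "finite (hex_verts c)" for c by (cases c) (simp add: hex_verts_def hex_edges_eq)
  then show "finite S \<Longrightarrow> finite (HV S)" by (simp add: HV_def)
qed

text \<open>The vertical lattice edges form a perfect matching of the whole lattice. It is the
  reference against which heights are measured.\<close>

lemma tri_horizontal:
  assumes "dual_triangle x y z"
  shows "of_bool (snd x = snd y) + of_bool (snd y = snd z) + of_bool (snd z = snd x) = (1::int)"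
proof -
  obtain i j where v: "triangle_at (i,j) x y z" using tri_vertex[OF assms] by (metis surj_pair)
  show ?thesis
  proof (cases "even (i + j)")
    case True
    show ?thesis using tri_at_sum[OF v tri_at_even[OF True], of "\<lambda>x y. of_bool (snd x = snd y)"] by simp
  next
    case False
    show ?thesis using tri_at_sum[OF v tri_at_odd[OF False], of "\<lambda>x y. of_bool (snd x = snd y)"] by simp
  qed
qed

text \<open>Inside the system, \<open>M\<close> minus the reference matching by vertical edges is
  closed. Vertices touching the outside may violate this, and these defects are drained without
  changing arcs within \<open>S\<close>.\<close>

lemma matching_height:
  assumes S: "S \<subseteq> cells" "finite S" "hex_connected (cells - S)"
    and M: "perfect_matching (HV S) (HE S) M"
  shows "\<exists>h :: vert \<Rightarrow> int. \<forall>x y. x \<in> S \<and> y \<in> S \<and> dual_arc x y \<longrightarrow>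
    h y = h x + (if shared_edge x y \<in> M then - 2 else 1)"
proof -
  obtain B where B: "\<And>x. x \<in> S \<Longrightarrow> \<bar>fst x\<bar> \<le> B" using finite_fst_bounds[OF S(2)] by blast
  define F where "F x y = (if x \<in> S \<or> y \<in> S then of_bool (shared_edge x y \<in> M) - of_bool (snd x = snd y) else 0 :: int)" for x y
  define D where "D v = (SOME d. \<forall>x y z. triangle_at v x y z \<longrightarrow> d = F x y + F y z + F z x)" for v
  have D: "F x y + F y z + F z x = D v" if t: "triangle_at v x y z" for v x y z
  proof -
    have "\<exists>d. \<forall>x y z. triangle_at v x y z \<longrightarrow> d = F x y + F y z + F z x"
      using tri_at_sum[OF t, of _ _ _ F] by blast
    then have "\<forall>x y z. triangle_at v x y z \<longrightarrow> D v = F x y + F y z + F z x"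
      unfolding D_def by (rule someI_ex)
    then have "D v = F x y + F y z + F z x" using t by blast
    then show ?thesis by simp
  qed
  define V where "V = {v\<in>HV S. drainable S v}"
  have finV: "finite V" using finite_HV[OF S(2)] by (simp add: V_def)
  have "\<forall>v\<in>V. \<exists>\<phi> :: vert \<Rightarrow> vert \<Rightarrow> int. \<exists>B. (\<forall>x y. x \<in> S \<and> y \<in> S \<longrightarrow> \<phi> x y = 0) \<and>
     (\<forall>x y. fst x < B \<longrightarrow> \<phi> x y = 0) \<and>
     (\<forall>u x y z. triangle_at u x y z \<longrightarrow> \<phi> x y + \<phi> y z + \<phi> z x = of_bool (u = v))"
    unfolding V_def drainable_def by blast
  then obtain \<phi> :: "vert \<Rightarrow> vert \<Rightarrow> vert \<Rightarrow> int" and b where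
    \<phi>: "\<And>v x y. v \<in> V \<Longrightarrow> x \<in> S \<Longrightarrow> y \<in> S \<Longrightarrow> \<phi> v x y = 0"
      "\<And>v x y. v \<in> V \<Longrightarrow> fst x < b v \<Longrightarrow> \<phi> v x y = 0"
      "\<And>v u x y z. v \<in> V \<Longrightarrow> triangle_at u x y z \<Longrightarrow> \<phi> v x y + \<phi> v y z + \<phi> v z x = of_bool (u = v)"
    by metis
  \<comment> \<open>Subtracting \<open>D v\<close> copies of the drain at each drainable
    \<open>v\<close> cancels all defects: at a vertex of the system that cannot be drained, all
    three cells lie in \<open>S\<close>, and the defect is already 0.\<close>
  define W where "W x y = F x y - (\<Sum>v\<in>V. D v * \<phi> v x y)" for x y
  have cl: "W x y + W y z + W z x = 0" if xyz: "dual_triangle x y z" for x y z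
  proof -
    obtain u where u: "triangle_at u x y z" using tri_vertex[OF xyz] by blast
    have "(\<Sum>v\<in>V. D v * \<phi> v x y) + (\<Sum>v\<in>V. D v * \<phi> v y z) + (\<Sum>v\<in>V. D v * \<phi> v z x)
      = (\<Sum>v\<in>V. D v * (\<phi> v x y + \<phi> v y z + \<phi> v z x))"
      by (simp add: sum.distrib distrib_left)
    also have "\<dots> = (\<Sum>v\<in>V. D v * of_bool (u = v))"
      by (rule sum.cong) (use \<phi>(3)[OF _ u] in simp_all)
    also have "\<dots> = (\<Sum>v\<in>V. if v = u then D v else 0)"
      by (rule sum.cong) auto
    also have "\<dots> = (if u \<in> V then D u else 0)"
      using finV by simp
    finally have "W x y + W y z + W z x = D u - (if u \<in> V then D u else 0)"
      using D[OF u] by (simp add: W_def)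
    moreover have "D u = 0" if "u \<notin> V"
    proof (cases "x \<in> S \<or> y \<in> S \<or> z \<in> S")
      case True
      have cells: "x \<in> cells" "y \<in> cells" "z \<in> cells" using xyz arr_cells unfolding dual_triangle_def by blast+
      then have uv: "u \<in> hex_verts x" "u \<in> hex_verts y" "u \<in> hex_verts z"
        using u unfolding triangle_at_def by blast+
      then have "u \<in> HV S" using True by (auto simp: HV_def)
      then have "\<not> drainable S u" using that by (simp add: V_def)
      then have "x \<in> S" "y \<in> S" "z \<in> S" using drainable_outside[OF S(2,3)] cells uv by blast+
      then have "F x y + F y z + F z x = 0"
        using matching_tri[OF S(1) M xyz] tri_horizontal[OF xyz] by (simp add: F_def)
      then show ?thesis using D[OF u] by simp
    next
      case False
      then show ?thesis using D[OF u] by (simp add: F_def)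
    qed
    ultimately show ?thesis by auto
  qed
  define B' where "B' = Min (insert (- B - 2) (b ` V))"
  have B': "B' \<le> - B - 2" "\<And>v. v \<in> V \<Longrightarrow> B' \<le> b v"
    using finV by (auto simp: B'_def)
  have far: "W x y = 0" if "dual_arc x y" "fst x < B'" for x y
  proof -
    have "x \<notin> S" "y \<notin> S" using that B[of x] B[of y] B'(1) arr_fst[OF that(1)] by force+
    moreover have "\<phi> v x y = 0" if "v \<in> V" for v using \<phi>(2)[OF that, of x y] B'(2)[OF that] \<open>fst x < B'\<close> by simp
    ultimately show ?thesis by (simp add: W_def F_def)
  qed
  obtain p where p: "\<And>x y. dual_arc x y \<Longrightarrow> W x y = p x - p y"
    using closed_form_exact[of W B', OF cl far] by blast
  \<comment> \<open>Along an arc \<open>fst\<close> changes by +2 if the arc is horizontal and by -1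
    otherwise. Subtracting it therefore cancels three times the reference term and leaves +1, or -2
    on a matched arc.\<close>
  define h where "h x = 3 * p x - fst x" for x
  have "h y = h x + (if shared_edge x y \<in> M then - 2 else 1)" if "x \<in> S" "y \<in> S" "dual_arc x y" for x y
  proof -
    have "(\<Sum>v\<in>V. D v * \<phi> v x y) = 0" using \<phi>(1) that by simp
    then have "of_bool (shared_edge x y \<in> M) - of_bool (snd x = snd y) = p x - p y"
      using p[OF that(3)] that by (simp add: W_def F_def)
    then show ?thesis using that(3) by (auto simp: h_def dual_arc_def)
  qed
  then show ?thesis by blast
qed

section \<open>Anti-forcing sets as dicut covers\<close>

definition directed_arc :: "bool \<Rightarrow> vert \<Rightarrow> vert \<Rightarrow> bool" where
  "directed_arc \<sigma> x y = (if \<sigma> then dual_arc x y else dual_arc y x)"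

definition dicut_side :: "vert set \<Rightarrow> edge set \<Rightarrow> bool \<Rightarrow> vert set \<Rightarrow> bool" where
  "dicut_side S M \<sigma> X \<longleftrightarrow> X \<subseteq> S \<and> X \<noteq> {} \<and> (\<forall>x y. directed_arc \<sigma> x y \<and> y \<in> X \<and> shared_edge x y \<notin> M \<longrightarrow> x \<in> X)"

definition separates :: "vert set \<Rightarrow> vert \<Rightarrow> vert \<Rightarrow> bool" where
  "separates X x y \<longleftrightarrow> (x \<in> X) \<noteq> (y \<in> X)"

definition cutset :: "edge set \<Rightarrow> vert set \<Rightarrow> edge set" where
  "cutset M X = {shared_edge x y | x y. dual_arc x y \<and> separates X x y \<and> shared_edge x y \<notin> M}"

definition flip :: "vert set \<Rightarrow> edge set \<Rightarrow> vert set \<Rightarrow> edge set" where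
  "flip S M X = {shared_edge x y | x y. dual_arc x y \<and> (x \<in> S \<or> y \<in> S) \<and> (shared_edge x y \<in> M) \<noteq> separates X x y}"

lemma cutset_iff: "dual_arc x y \<Longrightarrow> shared_edge x y \<in> cutset M X \<longleftrightarrow> separates X x y \<and> shared_edge x y \<notin> M"
  unfolding cutset_def using ed_inj by blast

lemma flip_iff:
  assumes "S \<subseteq> cells" "M \<subseteq> HE S" "X \<subseteq> S" "dual_arc x y"
  shows "shared_edge x y \<in> flip S M X \<longleftrightarrow> (shared_edge x y \<in> M) \<noteq> separates X x y"
proof -
  have "x \<in> S \<or> y \<in> S" if "(shared_edge x y \<in> M) \<noteq> separates X x y"
    using that assms ed_HE[OF assms(1,4)] by (auto simp: separates_def)
  then show ?thesis unfolding flip_def using ed_inj assms(4) by blast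
qed

text \<open>A triangle that is cut has one arc entering and one leaving the set. Closedness forces
  the one in the forbidden direction to be matched, hence the other is unmatched, and the flip
  merely exchanges them.\<close>

lemma sum_of_bool_flip:
  assumes "of_bool a + of_bool b + of_bool c = (1::int)"
    and "a \<or> (if s then y \<longrightarrow> x else x \<longrightarrow> y)"
    and "b \<or> (if s then z \<longrightarrow> y else y \<longrightarrow> z)"
    and "c \<or> (if s then x \<longrightarrow> z else z \<longrightarrow> x)"
  shows "of_bool (a \<noteq> (x \<noteq> y)) + of_bool (b \<noteq> (y \<noteq> z)) + of_bool (c \<noteq> (z \<noteq> x)) = (1::int)"
  using assms by (cases a; cases b; cases c; cases x; cases y; cases z; cases s; simp)

lemma flip_perfect_matching:
  assumes S: "S \<subseteq> cells" and M: "perfect_matching (HV S) (HE S) M" and X: "dicut_side S M \<sigma> X"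
  shows "perfect_matching (HV S) (HE S) (flip S M X)"
  unfolding perfect_matching_iff[OF S]
proof (intro conjI allI impI)
  show "flip S M X \<subseteq> HE S" unfolding flip_def using ed_HE[OF S] by blast
  fix x y z assume t: "dual_triangle x y z \<and> (x \<in> S \<or> y \<in> S \<or> z \<in> S)"
  have sub: "M \<subseteq> HE S" "X \<subseteq> S" using M X by (auto simp: perfect_matching_def dicut_side_def)
  have a: "dual_arc x y" "dual_arc y z" "dual_arc z x" using t by (auto simp: dual_triangle_def)
  have sum: "of_bool (shared_edge x y \<in> M) + of_bool (shared_edge y z \<in> M) + of_bool (shared_edge z x \<in> M) = (1::int)"
    using matching_tri[OF S M, of x y z] t by simp
  have cl: "if \<sigma> then q \<in> X \<longrightarrow> p \<in> X else p \<in> X \<longrightarrow> q \<in> X" if "dual_arc p q" "shared_edge p q \<notin> M" for p q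
    using X that ed_commute[of p q] unfolding dicut_side_def directed_arc_def by metis
  show "of_bool (shared_edge x y \<in> flip S M X) + of_bool (shared_edge y z \<in> flip S M X) + of_bool (shared_edge z x \<in> flip S M X) = (1::int)"
    unfolding flip_iff[OF S sub a(1)] flip_iff[OF S sub a(2)] flip_iff[OF S sub a(3)] separates_def
    by (rule sum_of_bool_flip[where s = \<sigma>]) (use sum cl a in blast)+
qed

text \<open>Both upper neighbours of a topmost cell of \<open>X\<close> lie outside
  \<open>X\<close>. Together with that cell they form a triangle with two cut arcs, of which at most
  one is matched.\<close>

lemma ex_cut_arc:
  assumes S: "S \<subseteq> cells" "finite S" and M: "perfect_matching (HV S) (HE S) M" and X: "X \<subseteq> S" "X \<noteq> {}"
  shows "\<exists>x y. dual_arc x y \<and> separates X x y \<and> shared_edge x y \<notin> M"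
proof -
  have "finite X" using X(1) S(2) by (rule finite_subset)
  then have fin: "finite (snd ` X)" "snd ` X \<noteq> {}" using X(2) by auto
  obtain c where c: "c \<in> X" "snd c = Max (snd ` X)" using Max_in[OF fin] by force
  have max: "snd x \<le> snd c" if "x \<in> X" for x using Max_ge[OF fin(1), of "snd x"] that c(2) by simp
  obtain i j where ij: "c = (i,j)" by force
  have e: "even (i + j)" using c X S ij by (auto simp: cells_def)
  have t: "dual_triangle (i,j) (i-1,j+1) (i+1,j+1)" using e by (auto simp: dual_triangle_def dual_arc_def)
  have "(i-1,j+1) \<notin> X" "(i+1,j+1) \<notin> X" using max[of "(i-1,j+1)"] max[of "(i+1,j+1)"] ij by auto
  then have s: "separates X (i,j) (i-1,j+1)" "separates X (i+1,j+1) (i,j)" using c ij by (auto simp: separates_def)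
  have "(i,j) \<in> S" using c X ij by blast
  then have "of_bool (shared_edge (i,j) (i-1,j+1) \<in> M) + of_bool (shared_edge (i-1,j+1) (i+1,j+1) \<in> M) + of_bool (shared_edge (i+1,j+1) (i,j) \<in> M) = (1::int)"
    using matching_tri[OF S(1) M t] by simp
  then have "shared_edge (i,j) (i-1,j+1) \<notin> M \<or> shared_edge (i+1,j+1) (i,j) \<notin> M"
    by (auto simp: of_bool_def split: if_splits)
  then show ?thesis using s t unfolding dual_triangle_def by blast
qed

text \<open>Flipping along \<open>X\<close> gives a different perfect matching, which must use an
  edge of \<open>A\<close>; all its edges outside \<open>M\<close> belong to the cut.\<close>

lemma anti_forcing_hits:
  assumes S: "S \<subseteq> cells" "finite S" and M: "perfect_matching (HV S) (HE S) M"
    and A: "anti_forcing_set (HV S) (HE S) M A" and X: "dicut_side S M \<sigma> X"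
  shows "A \<inter> cutset M X \<noteq> {}"
proof -
  have sub: "M \<subseteq> HE S" "X \<subseteq> S" "X \<noteq> {}" using M X by (auto simp: perfect_matching_def dicut_side_def)
  let ?M = "flip S M X"
  have pm: "perfect_matching (HV S) (HE S) ?M" by (rule flip_perfect_matching[OF S(1) M X])
  obtain x y where xy: "dual_arc x y" "separates X x y" "shared_edge x y \<notin> M" using ex_cut_arc[OF S M sub(2,3)] by blast
  then have "shared_edge x y \<in> ?M" using flip_iff[OF S(1) sub(1,2) xy(1)] by blast
  then have "?M \<noteq> M" using xy by blast
  then have "\<not> perfect_matching (HV S) (HE S - A) ?M" using A by (auto simp: anti_forcing_set_def)
  then have "\<not> ?M \<subseteq> HE S - A" using pm by (simp add: perfect_matching_def)
  then obtain e where e: "e \<in> ?M" "e \<in> A" using pm by (auto simp: perfect_matching_def)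
  have "e \<notin> M" using e A by (auto simp: anti_forcing_set_def)
  then have "e \<in> cutset M X" using e(1) unfolding flip_def cutset_def by blast
  then show ?thesis using e by blast
qed

text \<open>If another matching \<open>M'\<close> avoided \<open>A\<close>, the sets where the
  potential of \<open>M'\<close> against \<open>M\<close> is positive or negative would be dicut
  sides when nonempty. The potential drops along each unmatched cut arc, so all of these arcs lie in
  \<open>M'\<close> and none in \<open>A\<close>.\<close>

lemma hits_anti_forcing:
  assumes S: "S \<subseteq> cells" "finite S" "hex_connected (cells - S)" and M: "perfect_matching (HV S) (HE S) M"
    and A: "A \<subseteq> HE S - M" and hit: "\<And>\<sigma> X. dicut_side S M \<sigma> X \<Longrightarrow> A \<inter> cutset M X \<noteq> {}"
  shows "anti_forcing_set (HV S) (HE S) M A"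
proof -
  have "M' = M" if M': "perfect_matching (HV S) (HE S - A) M'" for M'
  proof -
    have pm: "perfect_matching (HV S) (HE S) M'" and dis: "M' \<inter> A = {}"
      using M' by (auto simp: perfect_matching_def)
    obtain p :: "vert \<Rightarrow> int" where
      p: "\<And>x y. dual_arc x y \<Longrightarrow> of_bool (shared_edge x y \<in> M') - of_bool (shared_edge x y \<in> M) = p x - p y"
      and p0: "\<And>x. x \<in> cells \<Longrightarrow> x \<notin> S \<Longrightarrow> p x = 0"
      using matching_potential[OF S M pm] by blast
    have up: "p y \<le> p x" if "dual_arc x y" "shared_edge x y \<notin> M" for x y
      using p[OF that(1)] that(2) by (cases "shared_edge x y \<in> M'") auto
    have not: "\<not> (p y < p x)" if "dual_arc x y" "shared_edge x y \<in> A" for x y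
      using p[OF that(1)] that(2) dis by (cases "shared_edge x y \<in> M'"; cases "shared_edge x y \<in> M") auto
    have lev: "\<not> dicut_side S M \<sigma> X" if X: "\<And>x y. dual_arc x y \<Longrightarrow> separates X x y \<Longrightarrow> p x \<noteq> p y" for \<sigma> X
    proof
      assume "dicut_side S M \<sigma> X"
      then obtain e where "e \<in> A" "e \<in> cutset M X" using hit by blast
      then obtain x y where xy: "dual_arc x y" "shared_edge x y \<in> A" "separates X x y" "shared_edge x y \<notin> M"
        by (auto simp: cutset_def)
      then have "p y < p x" using up[OF xy(1,4)] X[OF xy(1,3)] by simp
      then show False using not[OF xy(1,2)] by simp
    qed
    define U where "U = {x\<in>S. p x > 0}"
    define L where "L = {x\<in>S. p x < 0}"
    have iU: "x \<in> U \<longleftrightarrow> p x > 0" and iL: "x \<in> L \<longleftrightarrow> p x < 0" if "x \<in> cells" for x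
      using p0[OF that] by (cases "x \<in> S"; simp add: U_def L_def)+
    have "U = {}"
    proof (rule ccontr)
      assume ne: "U \<noteq> {}"
      have "dicut_side S M True U" unfolding dicut_side_def directed_arc_def
      proof (intro conjI allI impI)
        show "U \<subseteq> S" by (auto simp: U_def)
        fix x y assume xy: "(if True then dual_arc x y else dual_arc y x) \<and> y \<in> U \<and> shared_edge x y \<notin> M"
        then have "p y \<le> p x" "0 < p y" using up[of x y] by (auto simp: U_def)
        then show "x \<in> U" using iU[of x] arr_cells[of x y] xy by auto
      qed (rule ne)
      moreover have "p x \<noteq> p y" if "dual_arc x y" "separates U x y" for x y
        using that iU[of x] iU[of y] arr_cells[OF that(1)] by (auto simp: separates_def)
      ultimately show False using lev by blast
    qed
    have "L = {}"
    proof (rule ccontr)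
      assume ne: "L \<noteq> {}"
      have "dicut_side S M False L" unfolding dicut_side_def directed_arc_def
      proof (intro conjI allI impI)
        show "L \<subseteq> S" by (auto simp: L_def)
        fix x y assume xy: "(if False then dual_arc x y else dual_arc y x) \<and> y \<in> L \<and> shared_edge x y \<notin> M"
        then have "p x \<le> p y" "p y < 0" using up[of y x] ed_commute[of x y] by (auto simp: L_def)
        then show "x \<in> L" using iL[of x] arr_cells[of y x] xy by auto
      qed (rule ne)
      moreover have "p x \<noteq> p y" if "dual_arc x y" "separates L x y" for x y
        using that iL[of x] iL[of y] arr_cells[OF that(1)] by (auto simp: separates_def)
      ultimately show False using lev by blast
    qed
    have pz: "p x = 0" if "x \<in> cells" for x
      using iU[OF that] iL[OF that] \<open>U = {}\<close> \<open>L = {}\<close> by auto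
    have "e \<in> M' \<longleftrightarrow> e \<in> M" if "e \<in> HE S" for e
    proof -
      obtain x y where xy: "dual_arc x y" "e = shared_edge x y" using \<open>e \<in> HE S\<close> HE_iff[OF S(1)] by blast
      then show ?thesis using p[OF xy(1)] pz arr_cells[OF xy(1)] by (auto simp: of_bool_def split: if_splits)
    qed
    then show ?thesis using M pm by (auto simp: perfect_matching_def)
  qed
  moreover have "perfect_matching (HV S) (HE S - A) M"
    using M A by (auto simp: perfect_matching_def)
  ultimately show ?thesis using A unfolding anti_forcing_set_def by blast
qed

lemma finite_HE: "finite S \<Longrightarrow> finite (HE S)"
  by (simp add: HE_def hex_edges_def)

lemma cutset_subset:
  assumes "S \<subseteq> cells" "X \<subseteq> S"
  shows "cutset M X \<subseteq> HE S - M"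
  unfolding cutset_def separates_def using ed_HE[OF assms(1)] assms(2) by blast

context
  fixes S M
  assumes S: "S \<subseteq> cells" "finite S" "hex_connected (cells - S)"
    and M: "perfect_matching (HV S) (HE S) M"
begin

lemma ball_arcs: "(\<forall>e\<in>E. Q (fst e) (snd e)) \<longleftrightarrow> (\<forall>x y. (x,y) \<in> E \<longrightarrow> Q x y)"
  by auto

lemma anti_forcing_card_finite: "finite {card A | A. anti_forcing_set (HV S) (HE S) M A}"
proof (rule finite_subset)
  show "{card A | A. anti_forcing_set (HV S) (HE S) M A} \<subseteq> card ` Pow (HE S)"
    unfolding anti_forcing_set_def by blast
qed (use finite_HE[OF S(2)] in simp)

lemma af_le: "anti_forcing_set (HV S) (HE S) M A \<Longrightarrow> af S M \<le> card A"
  unfolding af_def by (rule Min_le[OF anti_forcing_card_finite]) blast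

lemma af_attained: "\<exists>A. anti_forcing_set (HV S) (HE S) M A \<and> card A = af S M"
proof -
  have "anti_forcing_set (HV S) (HE S) M (HE S - M)"
  proof (rule hits_anti_forcing[OF S M])
    fix \<sigma> X assume "dicut_side S M \<sigma> X"
    then have X: "X \<subseteq> S" "X \<noteq> {}" by (auto simp: dicut_side_def)
    have "cutset M X \<noteq> {}" using ex_cut_arc[OF S(1,2) M X] unfolding cutset_def by blast
    then show "(HE S - M) \<inter> cutset M X \<noteq> {}" using cutset_subset[OF S(1) X(1)] by blast
  qed simp
  then have "{card A | A. anti_forcing_set (HV S) (HE S) M A} \<noteq> {}" by blast
  then have "af S M \<in> {card A | A. anti_forcing_set (HV S) (HE S) M A}"
    unfolding af_def by (rule Min_in[OF anti_forcing_card_finite])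
  then obtain A where "af S M = card A" "anti_forcing_set (HV S) (HE S) M A" by blast
  then show ?thesis by (intro exI[of _ A]) simp
qed

lemma af_ge:
  assumes cl: "\<And>X. X \<in> G \<Longrightarrow> \<exists>\<sigma>. dicut_side S M \<sigma> X"
    and dis: "\<And>X Y x y. X \<in> G \<Longrightarrow> Y \<in> G \<Longrightarrow> X \<noteq> Y \<Longrightarrow> dual_arc x y \<Longrightarrow> shared_edge x y \<notin> M \<Longrightarrow> separates X x y \<Longrightarrow> \<not> separates Y x y"
  shows "card G \<le> af S M"
proof -
  obtain A where A: "anti_forcing_set (HV S) (HE S) M A" "card A = af S M" using af_attained by blast
  have finA: "finite A" using A finite_HE[OF S(2)] finite_subset unfolding anti_forcing_set_def by blast
  have "\<forall>X\<in>G. \<exists>e. e \<in> A \<and> e \<in> cutset M X"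
    using anti_forcing_hits[OF S(1,2) M A(1)] cl by blast
  then obtain g where g: "\<And>X. X \<in> G \<Longrightarrow> g X \<in> A \<and> g X \<in> cutset M X" by metis
  have "inj_on g G"
  proof (rule inj_onI, rule ccontr)
    fix X Y assume XY: "X \<in> G" "Y \<in> G" "g X = g Y" "X \<noteq> Y"
    have X: "g X \<in> cutset M X" and Y: "g X \<in> cutset M Y" using g XY by metis+
    obtain x y where xy: "dual_arc x y" "separates X x y" "shared_edge x y \<notin> M" "g X = shared_edge x y"
      using X unfolding cutset_def by blast
    then have "separates Y x y" using Y cutset_iff[OF xy(1)] by simp
    then show False using dis[OF XY(1,2,4) xy(1,3,2)] by blast
  qed
  moreover have "g ` G \<subseteq> A" using g by blast
  ultimately show ?thesis using card_inj_on_le finA A(2) by metis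
qed

lemma af_le_Af: "af S M \<le> Af S"
proof -
  have "{af S M | M. perfect_matching (HV S) (HE S) M} \<subseteq> af S ` Pow (HE S)"
    unfolding perfect_matching_def by blast
  then have "finite {af S M | M. perfect_matching (HV S) (HE S) M}"
    using finite_HE[OF S(2)] finite_subset by blast
  then show ?thesis unfolding Af_def by (rule Max_ge) (use M in blast)
qed

text \<open>The Lucchesi-Younger cover is an anti-forcing set, so the packing of equal size can be
  cut down to \<open>af S M\<close> members and then chosen with least weight. The last property
  expresses this choice: if the smaller side \<open>Z\<close> met no other cut, exchanging it for
  member \<open>i\<close> would lower the weight.\<close>

lemma minimal_packing:
  obtains f :: "nat \<Rightarrow> bool \<times> vert set" where
    "\<And>i. i < af S M \<Longrightarrow> dicut_side S M (fst (f i)) (snd (f i))"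
    "\<And>i j. i < af S M \<Longrightarrow> j < af S M \<Longrightarrow> snd (f i) \<subseteq> snd (f j) \<or> snd (f j) \<subseteq> snd (f i) \<or> snd (f i) \<inter> snd (f j) = {}"
    "\<And>i j x y. i < af S M \<Longrightarrow> j < af S M \<Longrightarrow> i \<noteq> j \<Longrightarrow> dual_arc x y \<Longrightarrow> shared_edge x y \<notin> M \<Longrightarrow>
       separates (snd (f i)) x y \<Longrightarrow> \<not> separates (snd (f j)) x y"
    "\<And>i \<sigma> Z. i < af S M \<Longrightarrow> dicut_side S M \<sigma> Z \<Longrightarrow> card Z < card (snd (f i)) \<Longrightarrow>
       \<exists>j x y. j < af S M \<and> j \<noteq> i \<and> dual_arc x y \<and> shared_edge x y \<notin> M \<and> separates Z x y \<and> separates (snd (f j)) x y"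
proof -
  define E where "E = {(x,y). dual_arc x y \<and> (x \<in> S \<or> y \<in> S) \<and> shared_edge x y \<notin> M}"
  have E_iff: "(x,y) \<in> E \<longleftrightarrow> dual_arc x y \<and> (x \<in> S \<or> y \<in> S) \<and> shared_edge x y \<notin> M" for x y by (simp add: E_def)
  have inj: "inj_on (\<lambda>(x,y). shared_edge x y) E"
  proof (rule inj_onI, clarify)
    fix x y x' y' assume "(x,y) \<in> E" "(x',y') \<in> E" "shared_edge x y = shared_edge x' y'"
    then show "x = x' \<and> y = y'" using ed_inj unfolding E_iff by blast
  qed
  have img: "(\<lambda>(x,y). shared_edge x y) ` E \<subseteq> HE S - M"
  proof (rule image_subsetI)
    fix a assume a: "a \<in> E"
    obtain x y where "a = (x,y)" by (cases a)
    then show "(case a of (x,y) \<Rightarrow> shared_edge x y) \<in> HE S - M" using a ed_HE[OF S(1)] E_iff[of x y] by simp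
  qed
  have finE: "finite E" using inj img finite_HE[OF S(2)] by (meson finite_Diff finite_imageD finite_subset)
  interpret dicuts E fst snd S by standard (use finE S in auto)
  have cut: "(x,y) \<in> cut X \<longleftrightarrow> dual_arc x y \<and> shared_edge x y \<notin> M \<and> separates X x y" if "X \<subseteq> S" for x y X
    using that unfolding cut_def separates_def by (auto simp: E_iff)
  have closed: "closed p \<longleftrightarrow> dicut_side S M (fst p) (snd p)" for p
  proof (cases "snd p \<subseteq> S")
    case True
    have "(\<forall>e\<in>E. if fst p then snd e \<in> snd p \<longrightarrow> fst e \<in> snd p else fst e \<in> snd p \<longrightarrow> snd e \<in> snd p) \<longleftrightarrow>
      (\<forall>x y. dual_arc x y \<and> (x \<in> S \<or> y \<in> S) \<and> shared_edge x y \<notin> M \<longrightarrow> (if fst p then y \<in> snd p \<longrightarrow> x \<in> snd p else x \<in> snd p \<longrightarrow> y \<in> snd p))"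
      using ball_arcs[of E "\<lambda>x y. if fst p then y \<in> snd p \<longrightarrow> x \<in> snd p else x \<in> snd p \<longrightarrow> y \<in> snd p"]
      unfolding E_iff .
    also have "\<dots> \<longleftrightarrow> (\<forall>x y. directed_arc (fst p) x y \<and> y \<in> snd p \<and> shared_edge x y \<notin> M \<longrightarrow> x \<in> snd p)"
    proof (cases "fst p")
      case fst: True
      show ?thesis unfolding directed_arc_def using True fst by (simp only: if_True) blast
    next
      case fst: False
      have "(\<forall>x y. dual_arc y x \<and> y \<in> snd p \<and> shared_edge x y \<notin> M \<longrightarrow> x \<in> snd p) \<longleftrightarrow>
        (\<forall>x y. dual_arc y x \<and> y \<in> snd p \<and> shared_edge y x \<notin> M \<longrightarrow> x \<in> snd p)"
        by (subst ed_commute) (rule refl)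
      then show ?thesis unfolding directed_arc_def using True fst by (simp only: if_False) blast
    qed
    finally show ?thesis unfolding closed_def dicut_side_def using True by blast
  next
    case False
    then show ?thesis by (simp add: closed_def dicut_side_def)
  qed
  have ne: "cut (snd p) \<noteq> {}" if "closed p" for p
  proof -
    have X: "snd p \<subseteq> S" "snd p \<noteq> {}" using that by (auto simp: closed_def)
    obtain x y where "dual_arc x y" "separates (snd p) x y" "shared_edge x y \<notin> M" using ex_cut_arc[OF S(1,2) M X] by blast
    then show ?thesis using cut[OF X(1)] by blast
  qed
  obtain J where J: "J \<subseteq> E" "\<And>p. closed p \<Longrightarrow> J \<inter> cut (snd p) \<noteq> {}" "has_packing (\<lambda>_. 1) (card J)"
    using Lucchesi_Younger[OF ne] by blast
  let ?A = "(\<lambda>(x,y). shared_edge x y) ` J"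
  have "anti_forcing_set (HV S) (HE S) M ?A"
  proof (rule hits_anti_forcing[OF S M])
    show "?A \<subseteq> HE S - M" using J(1) img by blast
    fix \<sigma> X assume X: "dicut_side S M \<sigma> X"
    then have sub: "X \<subseteq> S" by (simp add: dicut_side_def)
    obtain x y where xy: "(x,y) \<in> J" "(x,y) \<in> cut X" using J(2)[of "(\<sigma>,X)"] X closed by fastforce
    have "shared_edge x y \<in> ?A" using xy(1) by (rule rev_image_eqI) simp
    moreover have "shared_edge x y \<in> cutset M X" using xy(2) unfolding cut[OF sub] cutset_def by blast
    ultimately have "shared_edge x y \<in> ?A \<inter> cutset M X" by (rule IntI)
    then show "?A \<inter> cutset M X \<noteq> {}" by (metis empty_iff)
  qed
  from af_le[OF this] have "af S M \<le> card J"
    using card_image_le[of J "\<lambda>(x,y). shared_edge x y"] finite_subset[OF J(1) finE] by linarith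
  then have "has_packing (\<lambda>_. 1) (af S M)" using packs_mono[OF J(3)] by blast
  then obtain f where f: "minimal_packing_family {..<af S M} f (\<lambda>_. 1)" using ex_minimal_fam by blast
  then have packing: "packing {..<af S M} f (\<lambda>_. 1)" by (simp add: minimal_packing_family_def)
  have cl: "closed (f i)" if "i < af S M" for i using packing that by (auto simp: packing_def)
  have sub: "snd (f i) \<subseteq> S" if "i < af S M" for i using cl[OF that] by (auto simp: closed_def)
  show thesis
  proof (rule that[of f])
    show "dicut_side S M (fst (f i)) (snd (f i))" if "i < af S M" for i using cl[OF that] closed by blast
    show "snd (f i) \<subseteq> snd (f j) \<or> snd (f j) \<subseteq> snd (f i) \<or> snd (f i) \<inter> snd (f j) = {}"
      if "i < af S M" "j < af S M" for i j
      using minimal_fam_laminar[OF f] that unfolding laminar_def by blast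
    show "\<not> separates (snd (f j)) x y" if h: "i < af S M" "j < af S M" "i \<noteq> j" "dual_arc x y" "shared_edge x y \<notin> M"
      "separates (snd (f i)) x y" for i j x y
    proof
      assume s: "separates (snd (f j)) x y"
      let ?K = "{k\<in>{..<af S M}. (x,y) \<in> cut (snd (f k))}"
      have "(x,y) \<in> cut (snd (f i))" "(x,y) \<in> cut (snd (f j))" using h s cut sub by blast+
      then have "i \<in> ?K" "j \<in> ?K" "(x,y) \<in> E" using h by (auto simp: cut_def)
      moreover from this(3) have "card ?K \<le> Suc 0" using packing unfolding packing_def by auto
      ultimately show False using h(3) by (subst (asm) card_le_Suc0_iff_eq) auto
    qed
    show "\<exists>j x y. j < af S M \<and> j \<noteq> i \<and> dual_arc x y \<and> shared_edge x y \<notin> M \<and> separates Z x y \<and> separates (snd (f j)) x y"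
      if h: "i < af S M" "dicut_side S M \<sigma> Z" "card Z < card (snd (f i))" for i \<sigma> Z
    proof (rule ccontr)
      assume no: "\<not> ?thesis"
      have Z: "closed (\<sigma>, Z)" "Z \<subseteq> S" using h closed by (auto simp: dicut_side_def)
      let ?f = "f(i := (\<sigma>, Z))"
      have "card {k\<in>{..<af S M}. e \<in> cut (snd (?f k))} \<le> 1" if e: "e \<in> E" for e
      proof (cases "e \<in> cut Z")
        case True
        obtain x y where xy: "e = (x,y)" by (cases e)
        have "k = i" if "k < af S M" "e \<in> cut (snd (?f k))" for k
        proof (rule ccontr)
          assume "k \<noteq> i"
          then have "(x,y) \<in> cut (snd (f k))" using that xy by simp
          then show False using no True xy \<open>k \<noteq> i\<close> that(1) cut[OF Z(2)] cut[OF sub[OF that(1)]] by blast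
        qed
        then have "{k\<in>{..<af S M}. e \<in> cut (snd (?f k))} \<subseteq> {i}" by blast
        from card_mono[OF _ this] show ?thesis by simp
      next
        case False
        then have "{k\<in>{..<af S M}. e \<in> cut (snd (?f k))} \<subseteq> {k\<in>{..<af S M}. e \<in> cut (snd (f k))}"
          by (auto split: if_splits)
        from card_mono[OF _ this] have "card {k\<in>{..<af S M}. e \<in> cut (snd (?f k))} \<le> card {k\<in>{..<af S M}. e \<in> cut (snd (f k))}"
          by simp
        also have "\<dots> \<le> 1" using packing e unfolding packing_def by auto
        finally show ?thesis .
      qed
      then have "packing {..<af S M} ?f (\<lambda>_. 1)" using packing Z(1) unfolding packing_def by auto
      moreover have "(\<Sum>k<af S M. weight (snd (?f k))) < (\<Sum>k<af S M. weight (snd (f k)))"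
      proof (rule sum_strict_mono_ex1)
        have "weight Z < weight (snd (f i))" by (rule weight_strict_mono[OF h(3) sub[OF h(1)]])
        then show "\<forall>k\<in>{..<af S M}. weight (snd (?f k)) \<le> weight (snd (f k))"
          "\<exists>k\<in>{..<af S M}. weight (snd (?f k)) < weight (snd (f k))" using h(1) by auto
      qed simp
      ultimately show False using f unfolding minimal_packing_family_def by (meson not_le)
    qed
  qed
qed

end

section \<open>Rotating the lowest hexagons\<close>

lemma ex_arg_max_int:
  fixes g :: "'x \<Rightarrow> int"
  assumes "finite A" "A \<noteq> {}"
  shows "\<exists>m\<in>A. \<forall>x\<in>A. g x \<le> g m"
proof -
  have "Max (g ` A) \<in> g ` A" using assms by (intro Max_in) auto
  then obtain m where m: "m \<in> A" "g m = Max (g ` A)" by force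
  then show ?thesis using assms by (intro bexI[of _ m]) auto
qed

lemma arrow_iff:
  "directed_arc \<sigma> x y \<longleftrightarrow> even (fst x + snd x) \<and>
     (let e = if \<sigma> then 1 else -1 in
       y = (fst x - e, snd x - e) \<or> y = (fst x + 2 * e, snd x) \<or> y = (fst x - e, snd x + e))"
  unfolding directed_arc_def dual_arc_def Let_def by (cases x; cases y) auto

text \<open>A member \<open>t\<close> of \<open>K\<close> is sent to a common out-neighbour of two of its out-neighbours.  The extreme
  elements of \<open>Sig\<close> in three directions provide three out-neighbours that are not of this form.\<close>
lemma card_neighbours_ge:
  assumes Sig: "finite Sig" "Sig \<noteq> {}" "Sig \<subseteq> cells" and K: "K \<subseteq> cells"
    and KS: "\<And>t s. t \<in> K \<Longrightarrow> directed_arc \<sigma> t s \<Longrightarrow> s \<in> Sig"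
  shows "card K + 3 \<le> card {n. \<exists>s\<in>Sig. directed_arc \<sigma> s n}"
proof -
  define e :: int where "e = (if \<sigma> then 1 else -1)"
  have ee: "e * e = 1" "e * (e * z) = z" for z by (simp_all add: e_def)
  let ?N = "{n. \<exists>s\<in>Sig. directed_arc \<sigma> s n}"
  have arrI: "directed_arc \<sigma> x (fst x - e, snd x - e)" "directed_arc \<sigma> x (fst x + 2 * e, snd x)"
    "directed_arc \<sigma> x (fst x - e, snd x + e)" if "x \<in> cells" for x
    using that by (auto simp: arrow_iff cells_def e_def)
  have "?N \<subseteq> (\<lambda>x. (fst x - e, snd x - e)) ` Sig \<union> (\<lambda>x. (fst x + 2 * e, snd x)) ` Sig \<union> (\<lambda>x. (fst x - e, snd x + e)) ` Sig"
    unfolding arrow_iff e_def[symmetric] Let_def by blast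
  then have finN: "finite ?N" using Sig(1) by (meson finite_UnI finite_imageI finite_subset)
  \<comment> \<open>Each extreme cell is moved further out by one arc vector: \<open>n1\<close> lies
    beyond all second coordinates, \<open>n2\<close> and \<open>n3\<close> beyond the first ones on
    either side. The point \<open>\<phi> t\<close> stays within these ranges because the
    out-neighbours of \<open>t\<close> lie in \<open>Sig\<close>. The sign \<open>e\<close> treats
    both orientations at once.\<close>
  obtain s1 where s1: "s1 \<in> Sig" "\<And>x. x \<in> Sig \<Longrightarrow> e * snd x \<le> e * snd s1"
    using ex_arg_max_int[OF Sig(1,2), of "\<lambda>x. e * snd x"] by blast
  obtain s2 where s2: "s2 \<in> Sig" "\<And>x. x \<in> Sig \<Longrightarrow> e * fst s2 \<le> e * fst x"
    using ex_arg_max_int[OF Sig(1,2), of "\<lambda>x. - (e * fst x)"] by auto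
  obtain s3 where s3: "s3 \<in> Sig" "\<And>x. x \<in> Sig \<Longrightarrow> e * fst x \<le> e * fst s3"
    using ex_arg_max_int[OF Sig(1,2), of "\<lambda>x. e * fst x"] by blast
  define n1 n2 n3 where "n1 = (fst s1 - e, snd s1 + e)" and "n2 = (fst s2 - e, snd s2 - e)"
    and "n3 = (fst s3 + 2 * e, snd s3)"
  have sc: "s1 \<in> cells" "s2 \<in> cells" "s3 \<in> cells" using s1 s2 s3 Sig(3) by blast+
  have nN: "n1 \<in> ?N" "n2 \<in> ?N" "n3 \<in> ?N"
    unfolding n1_def n2_def n3_def using arrI[OF sc(1)] arrI[OF sc(2)] arrI[OF sc(3)] s1(1) s2(1) s3(1) by blast+
  have cp: "snd n1 * e = e * snd s1 + 1" "snd n2 * e = e * snd s2 - 1" "fst n1 * e = e * fst s1 - 1"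
     "fst n2 * e = e * fst s2 - 1" "fst n3 * e = e * fst s3 + 2"
    unfolding n1_def n2_def n3_def by (simp_all add: algebra_simps ee)
  have "n1 \<noteq> n2" using cp(1,2) s1(2)[OF s2(1)] by auto
  moreover have "n1 \<noteq> n3" using cp(3,5) s3(2)[OF s1(1)] by auto
  moreover have "n2 \<noteq> n3" using cp(4,5) s3(2)[OF s2(1)] by auto
  ultimately have c3: "card {n1, n2, n3} = 3" by simp
  define \<phi> where "\<phi> t = (fst t + e, snd t - e)" for t :: vert
  have inj: "inj_on \<phi> K" by (auto simp: inj_on_def \<phi>_def)
  have KSig: "(fst t - e, snd t - e) \<in> Sig" "(fst t + 2 * e, snd t) \<in> Sig" if "t \<in> K" for t
    using KS[OF that] arrI[of t] that K by blast+
  have "\<phi> ` K \<subseteq> ?N - {n1, n2, n3}"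
  proof (rule image_subsetI)
    fix t assume t: "t \<in> K"
    note 1 = KSig(1)[OF t] and 2 = KSig(2)[OF t]
    have "(fst t - e, snd t - e) \<in> cells" using 1 Sig(3) by blast
    from arrI(2)[OF this] have "directed_arc \<sigma> (fst t - e, snd t - e) (\<phi> t)"
      by (simp add: \<phi>_def add.commute)
    then have "\<phi> t \<in> ?N" using 1 by blast
    moreover have "\<phi> t \<noteq> n1" using s1(2)[OF 2] cp(1) by (auto simp: \<phi>_def algebra_simps ee)
    moreover have "\<phi> t \<noteq> n2" using s2(2)[OF 1] cp(4) by (auto simp: \<phi>_def algebra_simps ee)
    moreover have "\<phi> t \<noteq> n3" using s3(2)[OF 2] cp(5) by (auto simp: \<phi>_def algebra_simps ee)
    ultimately show "\<phi> t \<in> ?N - {n1, n2, n3}" by blast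
  qed
  from card_inj_on_le[OF inj this] have "card K \<le> card (?N - {n1, n2, n3})"
    using finN by (simp del: Diff_insert)
  also have "\<dots> = card ?N - 3" using nN c3 finN by (subst card_Diff_subset) auto
  finally have 1: "card K \<le> card ?N - 3" .
  have "card {n1, n2, n3} \<le> card ?N" by (rule card_mono[OF finN]) (use nN in blast)
  then show ?thesis using 1 c3 by linarith
qed

lemma arrow_tri:
  assumes "directed_arc \<sigma> x y"
  obtains z where "directed_arc \<sigma> y z" "directed_arc \<sigma> z x"
proof -
  have *: "\<exists>z. dual_arc q z \<and> dual_arc z p" if "dual_arc p q" for p q
    using that
  proof (cases rule: arr_cases)
    case (1 i j)
    then show ?thesis by (intro exI[of _ "(i-2,j)"]) (auto simp: dual_arc_def)
  next
    case (2 i j)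
    then show ?thesis by (intro exI[of _ "(i+1,j-1)"]) (auto simp: dual_arc_def)
  next
    case (3 i j)
    then show ?thesis by (intro exI[of _ "(i-2,j)"]) (auto simp: dual_arc_def)
  qed
  show thesis
  proof (cases \<sigma>)
    case True
    then show ?thesis using *[of x y] assms that by (auto simp: directed_arc_def)
  next
    case False
    then show ?thesis using *[of y x] assms that by (auto simp: directed_arc_def)
  qed
qed

lemma matching_arrow_tri:
  assumes "S \<subseteq> cells" "perfect_matching (HV S) (HE S) M" "directed_arc \<sigma> x y" "directed_arc \<sigma> y z" "directed_arc \<sigma> z x"
    and "x \<in> S \<or> y \<in> S \<or> z \<in> S"
  shows "(shared_edge x y \<in> M \<and> shared_edge y z \<notin> M \<and> shared_edge z x \<notin> M) \<or> (shared_edge x y \<notin> M \<and> shared_edge y z \<in> M \<and> shared_edge z x \<notin> M) \<or>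
     (shared_edge x y \<notin> M \<and> shared_edge y z \<notin> M \<and> shared_edge z x \<in> M)"
proof (cases \<sigma>)
  case True
  then have "dual_triangle x y z" using assms by (simp add: dual_triangle_def directed_arc_def)
  from matching_tri[OF assms(1,2) this] show ?thesis
    using assms(6) by (auto simp: of_bool_def split: if_splits)
next
  case False
  then have "dual_triangle y x z" using assms by (simp add: dual_triangle_def directed_arc_def)
  from matching_tri[OF assms(1,2) this] show ?thesis
    using assms(6) ed_commute[of x y] ed_commute[of y z] ed_commute[of z x]
    by (auto simp: of_bool_def split: if_splits)
qed

lemma arrow_irrefl: "\<not> directed_arc \<sigma> x x"
  using arr_irrefl by (simp add: directed_arc_def)

lemma arrow_not: "directed_arc (\<not> \<sigma>) x y \<longleftrightarrow> directed_arc \<sigma> y x"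
  by (simp add: directed_arc_def)

lemma sep_commute: "separates X x y \<longleftrightarrow> separates X y x"
  by (auto simp: separates_def)

lemma dcl_singleton: "dicut_side S M \<sigma> {c} \<longleftrightarrow> c \<in> S \<and> (\<forall>x. directed_arc \<sigma> x c \<longrightarrow> shared_edge x c \<in> M)"
  unfolding dicut_side_def using arrow_irrefl by blast

text \<open>The two types of a singleton dicut are the two ways to match every second side of the
  hexagon. Consecutive sides share a vertex and are never both matched, so one such triple forces
  full alternation.\<close>

lemma alternating_iff:
  assumes S: "S \<subseteq> cells" and M: "perfect_matching (HV S) (HE S) M" and c: "c \<in> S"
  shows "alternating_hex M c \<longleftrightarrow> (\<exists>\<sigma>. dicut_side S M \<sigma> {c})"
proof -
  obtain i j where ij: "c = (i,j)" by force
  have e: "even (i + j)" using c S ij by (auto simp: cells_def)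
  note he = hex_edge_ed[OF e, folded ij]
  let ?e = "\<lambda>k. hex_edge c k \<in> M"
  have in_arr: "dual_arc x c \<longleftrightarrow> x = (i+1,j-1) \<or> x = (i-2,j) \<or> x = (i+1,j+1)" for x
    using ij e by (cases x) (auto simp: dual_arc_def)
  have out_arr: "dual_arc c x \<longleftrightarrow> x = (i-1,j-1) \<or> x = (i+2,j) \<or> x = (i-1,j+1)" for x
    using ij e by (auto simp: dual_arc_def)
  have T: "dicut_side S M True {c} \<longleftrightarrow> ?e 1 \<and> ?e 3 \<and> ?e 5"
    unfolding dcl_singleton directed_arc_def if_True in_arr he using c by blast
  have F: "dicut_side S M False {c} \<longleftrightarrow> ?e 0 \<and> ?e 2 \<and> ?e 4"
    unfolding dcl_singleton directed_arc_def if_False out_arr he using c ed_commute by metis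
  have not2: "\<not> (shared_edge c y \<in> M \<and> shared_edge z c \<in> M)" if "dual_triangle c y z" for y z
    using matching_tri[OF S M that] c by (auto simp: of_bool_def split: if_splits)
  have "dual_triangle c (i-1,j-1) (i+1,j-1)" "dual_triangle c (i+2,j) (i+1,j-1)" "dual_triangle c (i+2,j) (i+1,j+1)"
    "dual_triangle c (i-1,j+1) (i+1,j+1)" "dual_triangle c (i-1,j+1) (i-2,j)" "dual_triangle c (i-1,j-1) (i-2,j)"
    using e ij by (auto simp: dual_triangle_def dual_arc_def)
  from this[THEN not2] have no: "\<not> (?e 0 \<and> ?e 1)" "\<not> (?e 2 \<and> ?e 1)" "\<not> (?e 2 \<and> ?e 3)" "\<not> (?e 4 \<and> ?e 3)"
     "\<not> (?e 4 \<and> ?e 5)" "\<not> (?e 0 \<and> ?e 5)"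
    unfolding he .
  have all6: "(\<forall>k<6. P k) \<longleftrightarrow> P 0 \<and> P 1 \<and> P 2 \<and> P 3 \<and> P 4 \<and> P (5::nat)" for P
    by (simp add: numeral_eq_Suc All_less_Suc conj_ac)
  have alt: "alternating_hex M c \<longleftrightarrow> (?e 0 \<longleftrightarrow> \<not> ?e 1) \<and> (?e 1 \<longleftrightarrow> \<not> ?e 2) \<and> (?e 2 \<longleftrightarrow> \<not> ?e 3) \<and>
     (?e 3 \<longleftrightarrow> \<not> ?e 4) \<and> (?e 4 \<longleftrightarrow> \<not> ?e 5) \<and> (?e 5 \<longleftrightarrow> \<not> ?e 0)"
  proof -
    have "(0 + 1) mod 6 = (1::nat)" "(1 + 1) mod 6 = (2::nat)" "(2 + 1) mod 6 = (3::nat)"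
      "(3 + 1) mod 6 = (4::nat)" "(4 + 1) mod 6 = (5::nat)" "(5 + 1) mod 6 = (0::nat)"
      by simp_all
    then show ?thesis unfolding alternating_hex_def all6 by (simp only:)
  qed
  have "(\<exists>\<sigma>. dicut_side S M \<sigma> {c}) \<longleftrightarrow> dicut_side S M True {c} \<or> dicut_side S M False {c}" by (metis (full_types))
  then show ?thesis unfolding alt T F using no by argo
qed

lemma fr_eq_card:
  assumes S: "S \<subseteq> cells" and M: "perfect_matching (HV S) (HE S) M"
  shows "fr S M = card {c. \<exists>\<sigma>. dicut_side S M \<sigma> {c}}"
proof -
  have "c \<in> S" if "dicut_side S M \<sigma> {c}" for c \<sigma> using that by (simp add: dicut_side_def)
  then have "{c\<in>S. alternating_hex M c} = {c. \<exists>\<sigma>. dicut_side S M \<sigma> {c}}"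
    using alternating_iff[OF S M] by blast
  then show ?thesis unfolding fr_def by simp
qed

text \<open>Distinct alternating hexagons have disjoint cuts: a common unmatched arc from
  \<open>x\<close> to \<open>y\<close> would force all arcs into \<open>x\<close> and all arcs out
  of \<open>y\<close> to be matched, giving two matched arcs in a triangle on that arc.\<close>

lemma fr_le_af:
  assumes S: "S \<subseteq> cells" "finite S" "hex_connected (cells - S)"
    and M: "perfect_matching (HV S) (HE S) M"
  shows "fr S M \<le> af S M"
proof -
  let ?C = "{c. \<exists>\<sigma>. dicut_side S M \<sigma> {c}}"
  have "card ((\<lambda>c. {c}) ` ?C) \<le> af S M"
  proof (rule af_ge[OF S M])
    show "\<exists>\<sigma>. dicut_side S M \<sigma> X" if "X \<in> (\<lambda>c. {c}) ` ?C" for X using that by blast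
    fix X Y x y assume X: "X \<in> (\<lambda>c. {c}) ` ?C" and Y: "Y \<in> (\<lambda>c. {c}) ` ?C" and ne: "X \<noteq> Y"
      and xy: "dual_arc x y" "shared_edge x y \<notin> M" and sX: "separates X x y"
    show "\<not> separates Y x y"
    proof
      assume "separates Y x y"
      moreover obtain c d where cd: "X = {c}" "Y = {d}" using X Y by blast
      ultimately have "(c = x \<and> d = y) \<or> (c = y \<and> d = x)" using sX ne by (auto simp: separates_def)
      then have "\<exists>\<sigma>. dicut_side S M \<sigma> {x}" "\<exists>\<sigma>. dicut_side S M \<sigma> {y}" using X Y cd by blast+
      moreover have "\<not> dicut_side S M True {y}" using xy unfolding dcl_singleton directed_arc_def if_True by blast
      moreover have "\<not> dicut_side S M False {x}"
        using xy unfolding dcl_singleton directed_arc_def if_False ed_commute[of x y] by blast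
      ultimately have d: "dicut_side S M True {x}" "dicut_side S M False {y}" by (metis (full_types))+
      have a: "directed_arc True x y" using xy by (simp add: directed_arc_def)
      obtain z where z: "directed_arc True y z" "directed_arc True z x" using arrow_tri[OF a] by blast
      have "shared_edge z x \<in> M" using d(1) z(2) unfolding dcl_singleton by blast
      moreover have "shared_edge y z \<in> M"
        using d(2) z(1) unfolding dcl_singleton directed_arc_def if_False if_True ed_commute[of y z] by blast
      moreover have "x \<in> S" using d(1) unfolding dcl_singleton by blast
      ultimately show False using matching_arrow_tri[OF S(1) M a z] by blast
    qed
  qed
  moreover have "card ((\<lambda>c. {c}) ` ?C) = card ?C" by (rule card_image) simp
  ultimately show ?thesis using fr_eq_card[OF S(1) M] by simp
qed

lemma nonsingleton_improvement:
  assumes S: "S \<subseteq> cells" "finite S" "hex_connected (cells - S)"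
    and M: "perfect_matching (HV S) (HE S) M"
    and cl: "\<And>i. i < af S M \<Longrightarrow> dicut_side S M (fst (f i)) (snd (f i))"
    and lam: "\<And>i j. i < af S M \<Longrightarrow> j < af S M \<Longrightarrow> snd (f i) \<subseteq> snd (f j) \<or> snd (f j) \<subseteq> snd (f i) \<or> snd (f i) \<inter> snd (f j) = {}"
    and dis: "\<And>i j x y. i < af S M \<Longrightarrow> j < af S M \<Longrightarrow> i \<noteq> j \<Longrightarrow> dual_arc x y \<Longrightarrow> shared_edge x y \<notin> M \<Longrightarrow>
       separates (snd (f i)) x y \<Longrightarrow> \<not> separates (snd (f j)) x y"
    and min: "\<And>i \<sigma> Z. i < af S M \<Longrightarrow> dicut_side S M \<sigma> Z \<Longrightarrow> card Z < card (snd (f i)) \<Longrightarrow>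
       \<exists>j x y. j < af S M \<and> j \<noteq> i \<and> dual_arc x y \<and> shared_edge x y \<notin> M \<and> separates Z x y \<and> separates (snd (f j)) x y"
    and big: "i0 < af S M" "1 < card (snd (f i0))"
  shows "\<exists>M'. perfect_matching (HV S) (HE S) M' \<and> af S M + 2 \<le> af S M'"
proof -

  \<comment> \<open>The family, with both orientations treated alike\<close>
  define k where "k = af S M"
  define X where "X j = snd (f j)" for j
  define \<tau> where "\<tau> j = fst (f j)" for j
  have Msub: "M \<subseteq> HE S" using M by (simp add: perfect_matching_def)
  have XS: "X j \<subseteq> S" "X j \<noteq> {}" "finite (X j)" if "j < k" for j
    using cl[of j] that S(2) finite_subset unfolding X_def k_def dicut_side_def by blast+
  have clX: "x \<in> X j" if "j < k" "directed_arc (\<tau> j) x y" "y \<in> X j" "shared_edge x y \<notin> M" for j x y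
    using cl[of j] that unfolding X_def k_def \<tau>_def dicut_side_def by blast
  have disX: "\<not> separates (X j) x y" if "i < k" "j < k" "i \<noteq> j" "directed_arc s x y" "shared_edge x y \<notin> M" "separates (X i) x y" for i j s x y
  proof (cases s)
    case True
    then show ?thesis using dis[of i j x y] that unfolding X_def k_def directed_arc_def by simp
  next
    case False
    then show ?thesis using dis[of i j y x] that ed_commute[of x y] sep_commute[of _ x y]
      unfolding X_def k_def directed_arc_def by simp
  qed
  have injX: "X i \<noteq> X j" if ij: "i < k" "j < k" "i \<noteq> j" for i j
  proof
    assume eq: "X i = X j"
    obtain x y where "dual_arc x y" "separates (X i) x y" "shared_edge x y \<notin> M"
      using ex_cut_arc[OF S(1,2) M XS(1,2)[OF ij(1)]] by blast
    then show False using dis[of i j x y] ij eq unfolding X_def k_def by simp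
  qed

  \<comment> \<open>A smallest member with several hexagons\<close>
  have "i0 \<in> {i. i < k \<and> 1 < card (X i)}" using big by (simp add: k_def X_def)
  then obtain i where i: "i < k" "1 < card (X i)"
    and imin: "\<And>j. j < k \<Longrightarrow> 1 < card (X j) \<Longrightarrow> card (X i) \<le> card (X j)"
    using ex_has_least_nat[of "\<lambda>i. i < k \<and> 1 < card (X i)" i0 "\<lambda>i. card (X i)"] by blast
  define \<sigma> where "\<sigma> = \<tau> i"
  have in_type: "\<tau> j \<noteq> \<sigma>" if "j < k" "directed_arc \<sigma> x y" "y \<in> X j" "x \<notin> X j" "shared_edge x y \<notin> M" for j x y
  proof
    assume "\<tau> j = \<sigma>"
    then have "directed_arc (\<tau> j) x y" using that(2) by simp
    then show False using clX[OF that(1)] that by blast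
  qed
  \<comment> \<open>Laminarity puts \<open>X j\<close> properly inside \<open>X i\<close>, and the
    minimal size of \<open>X i\<close> among the large members leaves only a singleton.\<close>
  have inner: "X j = {u}" if j: "j < k" "j \<noteq> i" and u: "u \<in> X j" "u \<in> X i" and w: "w \<in> X i" "w \<notin> X j" for j u w
  proof -
    have "X j \<subseteq> X i" using lam[of i j] j i u w unfolding X_def k_def by blast
    then have "X j \<subset> X i" using w by blast
    then have "card (X j) < card (X i)" using XS(3)[OF i(1)] by (simp add: psubset_card_mono)
    then have "card (X j) \<le> 1" using imin[OF j(1)] by linarith
    then show ?thesis using u(1) XS(3)[OF j(1)] card_le_Suc0_iff_eq by auto
  qed
  have clo: "x \<in> X i" if "directed_arc \<sigma> x y" "y \<in> X i" "shared_edge x y \<notin> M" for x y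
    using clX[OF i(1)] that unfolding \<sigma>_def by blast

  \<comment> \<open>Heights and the lowest hexagons\<close>
  obtain h :: "vert \<Rightarrow> int" where h: "\<And>x y. x \<in> S \<Longrightarrow> y \<in> S \<Longrightarrow> dual_arc x y \<Longrightarrow> h y = h x + (if shared_edge x y \<in> M then - 2 else 1)"
    using matching_height[OF S M] by blast
  define g where "g x = (if \<sigma> then h x else - h x)" for x
  have g: "g y = g x + (if shared_edge x y \<in> M then - 2 else 1)" if "x \<in> S" "y \<in> S" "directed_arc \<sigma> x y" for x y
    using h[of x y] h[of y x] that ed_commute[of x y] by (cases \<sigma>) (auto simp: g_def directed_arc_def)
  obtain s0 where s0: "s0 \<in> X i" "\<And>x. x \<in> X i \<Longrightarrow> g s0 \<le> g x"
    using ex_arg_max_int[OF XS(3,2)[OF i(1)], of "\<lambda>x. - g x"] by auto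
  define Sig where "Sig = {x \<in> X i. g x = g s0}"
  have SigX: "s \<in> X i" "g s = g s0" "s \<in> S" if "s \<in> Sig" for s
    using that XS(1)[OF i(1)] by (auto simp: Sig_def)
  have XiS: "x \<in> S" if "x \<in> X i" for x using that XS(1)[OF i(1)] by blast
  \<comment> \<open>The tail of an unmatched arc into \<open>s\<close> would lie in
    \<open>X i\<close>, one unit below the minimum.\<close>
  have src: "shared_edge y s \<in> M" if s: "s \<in> Sig" and a: "directed_arc \<sigma> y s" for s y
  proof (rule ccontr)
    assume n: "shared_edge y s \<notin> M"
    have y: "y \<in> X i" using clo[OF a SigX(1)[OF s] n] .
    have "g s = g y + 1" using g[OF XiS[OF y] SigX(3)[OF s] a] n by simp
    then show False using s0(2)[OF y] SigX(2)[OF s] by simp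
  qed
  have out: "\<exists>z. directed_arc \<sigma> n z \<and> directed_arc \<sigma> z s \<and> shared_edge z s \<in> M \<and> shared_edge s n \<notin> M \<and> shared_edge n z \<notin> M"
    if s: "s \<in> Sig" and a: "directed_arc \<sigma> s n" for s n
  proof -
    obtain z where z: "directed_arc \<sigma> n z" "directed_arc \<sigma> z s" using arrow_tri[OF a] by blast
    have m: "shared_edge z s \<in> M" using src[OF s z(2)] .
    then show ?thesis using matching_arrow_tri[OF S(1) M a z] SigX(3)[OF s] z m by blast
  qed
  have outM: "shared_edge s n \<notin> M" if "s \<in> Sig" "directed_arc \<sigma> s n" for s n using out[OF that] by blast
  \<comment> \<open>The side \<open>{s}\<close> is smaller than \<open>X i\<close>, so another
    member cuts an unmatched arc from \<open>s\<close> to some \<open>n\<close>. As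
    \<open>X i\<close> does not cut it, \<open>inner\<close> leaves \<open>{s}\<close> or
    \<open>{n}\<close>. The latter would have the opposite type, and the unmatched arc from
    \<open>n\<close> to the third cell \<open>z\<close> would pull \<open>z\<close> into it.\<close>
  have sing: "\<exists>j<k. j \<noteq> i \<and> X j = {s}" if s: "s \<in> Sig" for s
  proof -
    have d: "dicut_side S M \<sigma> {s}" using src[OF s] SigX(3)[OF s] unfolding dcl_singleton by blast
    have "card {s} < card (snd (f i))" using i(2) by (simp add: X_def)
    then obtain j x y where j: "j < k" "j \<noteq> i" and xy: "dual_arc x y" "shared_edge x y \<notin> M" "separates {s} x y" "separates (X j) x y"
      using min[OF i(1)[unfolded k_def] d] unfolding k_def X_def by blast
    have "\<exists>n. directed_arc \<sigma> s n \<and> shared_edge s n \<notin> M \<and> separates (X j) s n"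
    proof -
      consider "x = s" | "y = s" using xy(3) by (auto simp: separates_def)
      then show ?thesis
      proof cases
        case 1
        then have \<sigma> using src[OF s, of y] xy(1,2) ed_commute[of x y] by (cases \<sigma>) (auto simp: directed_arc_def)
        then show ?thesis using xy 1 by (intro exI[of _ y]) (simp add: directed_arc_def)
      next
        case 2
        then have "\<not> \<sigma>" using src[OF s, of x] xy(1,2) by (cases \<sigma>) (auto simp: directed_arc_def)
        then show ?thesis using xy 2 ed_commute[of x y] sep_commute[of _ x y] by (intro exI[of _ x]) (simp add: directed_arc_def)
      qed
    qed
    then obtain n where n: "directed_arc \<sigma> s n" "shared_edge s n \<notin> M" "separates (X j) s n" by blast
    have "\<not> separates (X i) s n" using disX[OF j(1) i(1) j(2) n] .
    then have nX: "n \<in> X i" using SigX(1)[OF s] by (simp add: separates_def)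
    show ?thesis
    proof (cases "s \<in> X j")
      case True
      then have "n \<notin> X j" using n(3) by (simp add: separates_def)
      then show ?thesis using inner[OF j True SigX(1)[OF s] nX] j by blast
    next
      case False
      then have "n \<in> X j" using n(3) by (simp add: separates_def)
      then have Xj: "X j = {n}" using inner[OF j _ nX SigX(1)[OF s] False] by blast
      obtain z where z: "directed_arc \<sigma> n z" "shared_edge n z \<notin> M" using out[OF s n(1)] by blast
      have "\<tau> j \<noteq> \<sigma>" using in_type[OF j(1) n(1) \<open>n \<in> X j\<close> False n(2)] .
      then have "directed_arc (\<tau> j) z n" using z(1) arrow_not[of \<sigma> z n] by (cases "\<tau> j"; cases \<sigma>) auto
      then have "z \<in> X j" using clX[OF j(1), of z n] \<open>n \<in> X j\<close> z(2) ed_commute[of n z] by simp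
      then have "z = n" using Xj by simp
      then show ?thesis using z(1) arrow_irrefl by metis
    qed
  qed
  have nbX: "n \<in> X i" if s: "s \<in> Sig" and a: "directed_arc \<sigma> s n" for s n
  proof -
    obtain j where j: "j < k" "j \<noteq> i" "X j = {s}" using sing[OF s] by blast
    have "s \<noteq> n" using a arrow_irrefl by metis
    then have "separates (X j) s n" using j(3) by (simp add: separates_def)
    then have "\<not> separates (X i) s n" using disX[OF j(1) i(1) j(2) a outM[OF s a]] by blast
    then show ?thesis using SigX(1)[OF s] by (simp add: separates_def)
  qed

  \<comment> \<open>Out-neighbours and the singletons that must go\<close>
  define N where "N = {n. \<exists>s\<in>Sig. directed_arc \<sigma> s n}"
  define K where "K = {t\<in>X i. (\<exists>j<k. X j = {t} \<and> \<tau> j \<noteq> \<sigma>) \<and> (\<exists>s\<in>Sig. directed_arc \<sigma> t s)}"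
  have NX: "n \<in> X i" "g n = g s0 + 1" "n \<notin> Sig" if "n \<in> N" for n
  proof -
    obtain s where s: "s \<in> Sig" "directed_arc \<sigma> s n" using \<open>n \<in> N\<close> by (auto simp: N_def)
    show nX: "n \<in> X i" using nbX[OF s] .
    show "g n = g s0 + 1" using g[OF SigX(3)[OF s(1)] XiS[OF nX] s(2)] outM[OF s] SigX(2)[OF s(1)] by simp
    then show "n \<notin> Sig" by (auto simp: Sig_def)
  qed
  have topM: "shared_edge t x \<in> M" if "j < k" "X j = {t}" "\<tau> j \<noteq> \<sigma>" "directed_arc \<sigma> t x" for j t x
  proof (rule ccontr)
    assume n: "shared_edge t x \<notin> M"
    have "directed_arc (\<tau> j) x t" using that(3,4) by (cases "\<tau> j"; cases \<sigma>) (auto simp: directed_arc_def)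
    then have "x \<in> X j" using clX[OF that(1)] that(2) n ed_commute[of t x] by auto
    then show False using that(2,4) arrow_irrefl by simp
  qed
  \<comment> \<open>All arcs out of \<open>t\<close> are matched and drop by 2, so they end at equal
    heights. Two unmatched arcs lead from \<open>s'\<close> through \<open>n\<close> back to
    \<open>t\<close>, which puts \<open>s'\<close> into \<open>X i\<close>.\<close>
  have KSig: "s' \<in> Sig" if t: "t \<in> K" and a: "directed_arc \<sigma> t s'" for t s'
  proof -
    obtain j s where j: "j < k" "X j = {t}" "\<tau> j \<noteq> \<sigma>" and s: "s \<in> Sig" "directed_arc \<sigma> t s" and tX: "t \<in> X i"
      using t by (auto simp: K_def simp del: split_paired_Ex)
    note top = topM[OF j]
    have gt: "g s = g t - 2" using g[OF XiS[OF tX] SigX(3)[OF s(1)] s(2)] top[OF s(2)] by simp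
    obtain n where n: "directed_arc \<sigma> s' n" "directed_arc \<sigma> n t" using arrow_tri[OF a] by blast
    have "shared_edge s' n \<notin> M" "shared_edge n t \<notin> M"
      using matching_arrow_tri[OF S(1) M a n] top[OF a] XiS[OF tX] by blast+
    then have nX: "n \<in> X i" and s'X: "s' \<in> X i" using clo n tX by blast+
    have "g s' = g t - 2" using g[OF XiS[OF tX] XiS[OF s'X] a] top[OF a] by simp
    then show ?thesis using gt SigX(2)[OF s(1)] s'X by (simp add: Sig_def)
  qed
  have "s0 \<in> Sig" "Sig \<subseteq> X i" using s0(1) by (simp_all add: Sig_def)
  then have Signe: "Sig \<noteq> {}" "Sig \<subseteq> X i" "finite Sig" "Sig \<subseteq> cells" "Sig \<subseteq> S"
    using XS[OF i(1)] S(1) finite_subset by blast+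
  have Kc: "K \<subseteq> cells" "finite K" "K \<subseteq> X i" using XS[OF i(1)] S(1) by (auto simp: K_def)
  have count: "card K + 3 \<le> card N"
    unfolding N_def by (rule card_neighbours_ge[OF Signe(3,1,4) Kc(1) KSig])

  \<comment> \<open>The rotated matching\<close>
  define M' where "M' = flip S M Sig"
  have dSig: "dicut_side S M \<sigma> Sig" unfolding dicut_side_def using src Signe by blast
  have pm': "perfect_matching (HV S) (HE S) M'" unfolding M'_def by (rule flip_perfect_matching[OF S(1) M dSig])
  have flipM: "shared_edge x y \<in> M' \<longleftrightarrow> (shared_edge x y \<in> M) \<noteq> separates Sig x y" if a: "directed_arc \<sigma> x y" for x y
    using flip_iff[OF S(1) Msub Signe(5), of x y] flip_iff[OF S(1) Msub Signe(5), of y x] a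
      ed_commute[of x y] sep_commute[of Sig x y]
    unfolding M'_def directed_arc_def by (auto split: if_splits)
  have nonM': "y \<in> Sig \<or> (x \<notin> Sig \<and> shared_edge x y \<notin> M)" if a: "directed_arc \<sigma> x y" "shared_edge x y \<notin> M'" for x y
    using flipM[OF a(1)] a(2) outM[of x y] a(1) by (auto simp: separates_def)

  \<comment> \<open>Members that survive the rotation\<close>
  define old where "old j \<longleftrightarrow> j < k \<and> j \<noteq> i \<and> (\<forall>s\<in>Sig. X j \<noteq> {s}) \<and> (\<forall>t\<in>K. X j \<noteq> {t})" for j
  \<comment> \<open>The arc from \<open>s\<close> to the third cell \<open>n\<close> is already used
    by the member \<open>{s}\<close>, so a cut of the arc from \<open>m\<close> to \<open>s\<close>
    would also cut the unmatched arc from \<open>n\<close> to \<open>m\<close>. Then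
    \<open>m\<close> is in \<open>X i\<close>, and \<open>inner\<close> makes the member
    \<open>{m}\<close>, hence in \<open>K\<close>, or \<open>{s}\<close>.\<close>
  have old_sep: "\<not> separates (X j) m s" if j: "old j" and s: "s \<in> Sig" and a: "directed_arc \<sigma> m s" for j m s
  proof
    assume sp: "separates (X j) m s"
    have jk: "j < k" "j \<noteq> i" using j by (auto simp: old_def)
    obtain l where l: "l < k" "l \<noteq> i" "X l = {s}" using sing[OF s] by blast
    have lj: "l \<noteq> j" using l(3) j s unfolding old_def by blast
    obtain n where n: "directed_arc \<sigma> s n" "directed_arc \<sigma> n m" using arrow_tri[OF a] by blast
    have nM: "shared_edge s n \<notin> M" "shared_edge n m \<notin> M"
      using matching_arrow_tri[OF S(1) M a n] src[OF s a] SigX(3)[OF s] by blast+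
    have "s \<noteq> n" using n(1) arrow_irrefl by metis
    then have "separates (X l) s n" using l(3) by (simp add: separates_def)
    then have "\<not> separates (X j) s n" using disX[OF l(1) jk(1) lj n(1) nM(1)] by blast
    then have spn: "separates (X j) n m" using sp by (auto simp: separates_def)
    have nX: "n \<in> X i" using nbX[OF s n(1)] .
    have "\<not> separates (X i) n m" using disX[OF jk(1) i(1) jk(2) n(2) nM(2) spn] .
    then have mX: "m \<in> X i" using nX by (simp add: separates_def)
    show False
    proof (cases "m \<in> X j")
      case True
      then have "s \<notin> X j" "n \<notin> X j" using sp spn by (auto simp: separates_def)
      then have Xj: "X j = {m}" using inner[OF jk True mX SigX(1)[OF s]] by blast
      have "\<tau> j \<noteq> \<sigma>" using in_type[OF jk(1) n(2) True \<open>n \<notin> X j\<close> nM(2)] .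
      then have "m \<in> K" using mX s a Xj jk(1) unfolding K_def by blast
      then show False using j Xj unfolding old_def by blast
    next
      case False
      then have "s \<in> X j" using sp by (auto simp: separates_def)
      then have "X j = {s}" using inner[OF jk _ SigX(1)[OF s] mX False] by blast
      then show False using j s unfolding old_def by blast
    qed
  qed
  have old_cut: "shared_edge p q \<notin> M \<and> q \<notin> Sig" if "old j" "directed_arc \<sigma> p q" "shared_edge p q \<notin> M'" "separates (X j) p q" for j p q
    using nonM'[OF that(2,3)] old_sep[OF that(1) _ that(2)] that(4) by blast
  have sig_cut: "q = s" if "s \<in> Sig" "directed_arc \<sigma> p q" "shared_edge p q \<notin> M'" "separates {s} p q" for s p q
  proof (rule ccontr)
    assume "q \<noteq> s"
    then have "p = s" using that(4) by (auto simp: separates_def)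
    then have "q \<in> Sig" using nonM'[OF that(2,3)] that(1) by blast
    then show False using src[of q p] outM[of p q] that \<open>p = s\<close> by blast
  qed
  \<comment> \<open>An arc into \<open>n\<close> that is unmatched after the rotation would come
    from a cell of \<open>X i\<close> one unit below \<open>n\<close>, that is from
    \<open>Sig\<close>; but the arcs leaving \<open>Sig\<close> have just become matched.\<close>
  have N_in: "shared_edge p n \<in> M'" if n: "n \<in> N" and a: "directed_arc \<sigma> p n" for n p
  proof (rule ccontr)
    assume m: "shared_edge p n \<notin> M'"
    then have p: "p \<notin> Sig" "shared_edge p n \<notin> M" using nonM'[OF a m] NX(3)[OF n] by blast+
    have pX: "p \<in> X i" using clo[OF a NX(1)[OF n] p(2)] .
    have "g p = g s0" using g[OF XiS[OF pX] XiS[OF NX(1)[OF n]] a] p(2) NX(2)[OF n] by simp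
    then show False using p(1) pX by (simp add: Sig_def)
  qed
  have N_cut: "p = n" if "n \<in> N" "directed_arc \<sigma> p q" "shared_edge p q \<notin> M'" "separates {n} p q" for n p q
    using N_in[OF that(1), of p] that by (auto simp: separates_def)
  \<comment> \<open>As before, the member could only be \<open>{s}\<close> or a singleton
    \<open>{q}\<close> of the opposite type. In the latter case the third cell \<open>u\<close> lies
    one unit below \<open>n\<close>, hence in \<open>Sig\<close>, so \<open>q\<close> is in
    \<open>K\<close>.\<close>
  have old_N: False if j: "old j" and n: "n \<in> N" and a: "directed_arc \<sigma> p q" "shared_edge p q \<notin> M'" and sp: "separates (X j) p q" "separates {n} p q" for j n p q
  proof -
    have jk: "j < k" "j \<noteq> i" using j by (auto simp: old_def)
    have pn: "p = n" using N_cut[OF n a sp(2)] .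
    have nM: "shared_edge n q \<notin> M" using old_cut[OF j a sp(1)] pn by blast
    have aq: "directed_arc \<sigma> n q" and sq: "separates (X j) n q" using a sp(1) pn by auto
    obtain s where s: "s \<in> Sig" "directed_arc \<sigma> s n" using n by (auto simp: N_def)
    obtain l where l: "l < k" "l \<noteq> i" "X l = {s}" using sing[OF s(1)] by blast
    have lj: "l \<noteq> j" using l(3) j s unfolding old_def by blast
    have "s \<noteq> n" using s(2) arrow_irrefl by metis
    then have "separates (X l) s n" using l(3) by (simp add: separates_def)
    then have nsn: "\<not> separates (X j) s n" using disX[OF l(1) jk(1) lj s(2) outM[OF s]] by blast
    have nX: "n \<in> X i" using NX(1)[OF n] .
    have "\<not> separates (X i) n q" using disX[OF jk(1) i(1) jk(2) aq nM sq] .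
    then have qX: "q \<in> X i" using nX by (simp add: separates_def)
    show False
    proof (cases "n \<in> X j")
      case True
      then have "s \<in> X j" "q \<notin> X j" using nsn sq by (auto simp: separates_def)
      then have "X j = {s}" using inner[OF jk _ SigX(1)[OF s(1)] qX] by blast
      then show False using j s(1) unfolding old_def by blast
    next
      case False
      then have qj: "q \<in> X j" using sq by (simp add: separates_def)
      then have Xj: "X j = {q}" using inner[OF jk _ qX nX False] by blast
      have tj: "\<tau> j \<noteq> \<sigma>" using in_type[OF jk(1) aq qj False nM] .
      obtain u where u: "directed_arc \<sigma> q u" "directed_arc \<sigma> u n" using arrow_tri[OF aq] by blast
      have "shared_edge q u \<in> M" using topM[OF jk(1) Xj tj u(1)] .
      then have un: "shared_edge u n \<notin> M" using matching_arrow_tri[OF S(1) M aq u] XiS[OF nX] by blast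
      have uX: "u \<in> X i" using clo[OF u(2) nX un] .
      have "g u = g s0" using g[OF XiS[OF uX] XiS[OF nX] u(2)] un NX(2)[OF n] by simp
      then have "u \<in> Sig" using uX by (simp add: Sig_def)
      then have "q \<in> K" using qX jk(1) Xj tj u(1) unfolding K_def by blast
      then show False using j Xj unfolding old_def by blast
    qed
  qed
  have sig_N: False if s: "s \<in> Sig" and n: "n \<in> N" and a: "directed_arc \<sigma> p q" "shared_edge p q \<notin> M'" and sp: "separates {s} p q" "separates {n} p q" for s n p q
  proof -
    have q: "q = s" "p = n" using sig_cut[OF s a sp(1)] N_cut[OF n a sp(2)] by auto
    then have "shared_edge n s \<in> M" "directed_arc \<sigma> n s" using src[OF s, of n] a(1) by auto
    then have "g s = g n - 2" using g[OF XiS[OF NX(1)[OF n]] SigX(3)[OF s]] by simp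
    then show False using NX(2)[OF n] SigX(2)[OF s] by simp
  qed
  have old_sig: False if j: "old j" and s: "s \<in> Sig" and a: "directed_arc \<sigma> p q" "shared_edge p q \<notin> M'" and sp: "separates (X j) p q" "separates {s} p q" for j s p q
    using sig_cut[OF s a sp(2)] old_cut[OF j a sp(1)] s by blast

  \<comment> \<open>The new family of disjoint dicuts\<close>
  let ?old = "X ` {..<k} - {X i} - (\<lambda>t. {t}) ` K"
  \<comment> \<open>The singletons of \<open>Sig\<close> remain inside \<open>?old\<close>: they are
    members already, and the rotation only reverses their type.\<close>
  define G where "G = ?old \<union> (\<lambda>n. {n}) ` N"
  have cases: "(\<exists>j. old j \<and> Y = X j) \<or> (\<exists>s\<in>Sig. Y = {s}) \<or> (\<exists>n\<in>N. Y = {n})" if "Y \<in> G" for Y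
    using that unfolding G_def old_def by blast
  have "card G \<le> af S M'"
  proof (rule af_ge[OF S pm'])
    fix Y assume "Y \<in> G"
    from cases[OF this] show "\<exists>\<sigma>. dicut_side S M' \<sigma> Y"
    proof (elim disjE exE bexE conjE)
      fix j assume j: "old j" and Y: "Y = X j"
      have jk: "j < k" using j by (simp add: old_def)
      have "x \<in> X j" if a: "directed_arc (\<tau> j) x y" "y \<in> X j" "shared_edge x y \<notin> M'" for x y
      proof (rule ccontr)
        assume x: "x \<notin> X j"
        have sp: "separates (X j) x y" using a(2) x by (simp add: separates_def)
        have "shared_edge x y \<notin> M"
        proof (cases "\<tau> j = \<sigma>")
          case True
          then show ?thesis using old_cut[OF j _ a(3) sp] a(1) by simp
        next
          case False
          then have "directed_arc \<sigma> y x" using a(1) by (cases "\<tau> j"; cases \<sigma>) (auto simp: directed_arc_def)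
          then show ?thesis using old_cut[OF j, of y x] a(3) sp ed_commute[of x y] sep_commute[of _ x y] by simp
        qed
        then show False using clX[OF jk a(1,2)] x by blast
      qed
      then have "dicut_side S M' (\<tau> j) (X j)" using XS[OF jk] unfolding dicut_side_def by blast
      then show ?thesis using Y by blast
    next
      fix s assume s: "s \<in> Sig" and Y: "Y = {s}"
      have "shared_edge x s \<in> M'" if "directed_arc (\<not> \<sigma>) x s" for x
      proof (rule ccontr)
        assume n: "shared_edge x s \<notin> M'"
        have a: "directed_arc \<sigma> s x" using that arrow_not by simp
        have "s \<noteq> x" using a arrow_irrefl by metis
        then show False using sig_cut[OF s a] n ed_commute[of x s] by (auto simp: separates_def)
      qed
      then have "dicut_side S M' (\<not> \<sigma>) {s}" using SigX(3)[OF s] unfolding dcl_singleton by blast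
      then show ?thesis using Y by blast
    next
      fix n assume n: "n \<in> N" and Y: "Y = {n}"
      have "dicut_side S M' \<sigma> {n}" using N_in[OF n] XiS[OF NX(1)[OF n]] unfolding dcl_singleton by blast
      then show ?thesis using Y by blast
    qed
  next
    fix Y Z x y assume Y: "Y \<in> G" and Z: "Z \<in> G" and ne: "Y \<noteq> Z" and xy: "dual_arc x y" "shared_edge x y \<notin> M'" "separates Y x y"
    show "\<not> separates Z x y"
    proof
      assume sZ: "separates Z x y"
      obtain p q where a: "directed_arc \<sigma> p q" "shared_edge p q \<notin> M'" and sp: "separates Y p q" "separates Z p q"
      proof (cases \<sigma>)
        case True
        then show thesis using that[of x y] xy sZ by (simp add: directed_arc_def)
      next
        case False
        then show thesis using that[of y x] xy sZ ed_commute[of x y] sep_commute[of _ x y] by (simp add: directed_arc_def)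
      qed
      have oo: False if "old j" "old l" "Y = X j" "Z = X l" for j l
      proof -
        have "j \<noteq> l" "j < k" "l < k" using that ne by (auto simp: old_def)
        moreover have "shared_edge p q \<notin> M" using old_cut[OF that(1) a] sp(1) that(3) by blast
        ultimately show False using disX[of j l \<sigma> p q] a sp that by blast
      qed
      from cases[OF Y] cases[OF Z] show False
      proof (elim disjE exE bexE conjE)
        show False if "old j" "Y = X j" "old l" "Z = X l" for j l using oo that by blast
        show False if "old j" "Y = X j" "s \<in> Sig" "Z = {s}" for j s using old_sig[OF that(1,3) a] sp that by blast
        show False if "old j" "Y = X j" "n \<in> N" "Z = {n}" for j n using old_N[OF that(1,3) a] sp that by blast
        show False if "s \<in> Sig" "Y = {s}" "old j" "Z = X j" for j s using old_sig[OF that(3,1) a] sp that by blast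
        show False if "s \<in> Sig" "Y = {s}" "t \<in> Sig" "Z = {t}" for s t
          using sig_cut[OF that(1) a] sig_cut[OF that(3) a] sp that ne by blast
        show False if "s \<in> Sig" "Y = {s}" "n \<in> N" "Z = {n}" for s n using sig_N[OF that(1,3) a] sp that by blast
        show False if "n \<in> N" "Y = {n}" "old j" "Z = X j" for j n using old_N[OF that(3,1) a] sp that by blast
        show False if "n \<in> N" "Y = {n}" "s \<in> Sig" "Z = {s}" for s n using sig_N[OF that(3,1) a] sp that by blast
        show False if "n \<in> N" "Y = {n}" "m \<in> N" "Z = {m}" for n m
          using N_cut[OF that(1) a] N_cut[OF that(3) a] sp that ne by blast
      qed
    qed
  qed

  \<comment> \<open>Counting the new family\<close>
  moreover have "k + 2 \<le> card G"
  proof -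
    have finN: "finite N" using XS(3)[OF i(1)] NX(1) by (meson finite_subset subsetI)
    have cX: "card (X ` {..<k}) = k" using card_image[of X "{..<k}"] injX by (auto simp: inj_on_def)
    have s1: "X i \<in> X ` {..<k}" using i(1) by simp
    have s2: "(\<lambda>t. {t}) ` K \<subseteq> X ` {..<k} - {X i}"
    proof (rule image_subsetI)
      fix t assume "t \<in> K"
      then obtain j where j: "j < k" "X j = {t}" unfolding K_def by blast
      then have "{t} \<noteq> X i" using i(2) by (metis card_1_singleton_iff One_nat_def less_irrefl)
      then show "{t} \<in> X ` {..<k} - {X i}" using j by (metis DiffI imageI lessThan_iff singletonD)
    qed
    have "card ?old = card (X ` {..<k} - {X i}) - card ((\<lambda>t. {t}) ` K)"
      by (rule card_Diff_subset) (use s2 Kc(2) in auto)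
    also have "card (X ` {..<k} - {X i}) = k - 1" using s1 cX by simp
    also have "card ((\<lambda>t. {t}) ` K) = card K" by (rule card_image) simp
    finally have c1: "card ?old = k - 1 - card K" .
    have "card ((\<lambda>t. {t}) ` K) \<le> card (X ` {..<k} - {X i})" by (rule card_mono[OF _ s2]) simp
    then have c2: "card K \<le> k - 1" using s1 cX by (simp add: card_image)
    \<comment> \<open>If \<open>{n}\<close> were a member already, it would share the unmatched arc
      from \<open>s\<close> to \<open>n\<close> with the member \<open>{s}\<close>.\<close>
    have "{n} \<notin> X ` {..<k}" if n: "n \<in> N" for n
    proof
      assume "{n} \<in> X ` {..<k}"
      then obtain j where j: "j < k" "X j = {n}" by (metis imageE lessThan_iff)
      obtain s where s: "s \<in> Sig" "directed_arc \<sigma> s n" using n by (auto simp: N_def)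
      obtain l where l: "l < k" "X l = {s}" using sing[OF s(1)] by blast
      have "s \<noteq> n" using s(2) arrow_irrefl by metis
      then have "l \<noteq> j" "separates (X l) s n" "separates (X j) s n" using l j by (auto simp: separates_def)
      then show False using disX[OF l(1) j(1) _ s(2) outM[OF s]] by blast
    qed
    then have "?old \<inter> (\<lambda>n. {n}) ` N = {}" by blast
    then have "card G = card ?old + card ((\<lambda>n. {n}) ` N)"
      unfolding G_def by (intro card_Un_disjoint) (use finN in auto)
    also have "card ((\<lambda>n. {n}) ` N) = card N" by (rule card_image) simp
    finally show ?thesis using c1 c2 count i(1) by linarith
  qed
  ultimately show ?thesis using pm' unfolding k_def by (intro exI[of _ M']) simp
qed

theorem theorem1p7:
  fixes S :: "(int \<times> int) set" and M :: "(int \<times> int) set set"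
  assumes "hexagonal_system S"
    and "perfect_matching (HV S) (HE S) M"
    and "af S M = Af S \<or> af S M = Af S - 1"
  shows "af S M = fr S M"
proof -
  have S: "S \<subseteq> cells" "finite S" "hex_connected (cells - S)"
    using assms(1) by (auto simp: hexagonal_system_def)
  note M = assms(2)
  obtain f :: "nat \<Rightarrow> bool \<times> vert set" where
    cl: "\<And>i. i < af S M \<Longrightarrow> dicut_side S M (fst (f i)) (snd (f i))" and
    lam: "\<And>i j. i < af S M \<Longrightarrow> j < af S M \<Longrightarrow> snd (f i) \<subseteq> snd (f j) \<or> snd (f j) \<subseteq> snd (f i) \<or> snd (f i) \<inter> snd (f j) = {}" and
    dis: "\<And>i j x y. i < af S M \<Longrightarrow> j < af S M \<Longrightarrow> i \<noteq> j \<Longrightarrow> dual_arc x y \<Longrightarrow> shared_edge x y \<notin> M \<Longrightarrow>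
       separates (snd (f i)) x y \<Longrightarrow> \<not> separates (snd (f j)) x y" and
    min: "\<And>i \<sigma> Z. i < af S M \<Longrightarrow> dicut_side S M \<sigma> Z \<Longrightarrow> card Z < card (snd (f i)) \<Longrightarrow>
       \<exists>j x y. j < af S M \<and> j \<noteq> i \<and> dual_arc x y \<and> shared_edge x y \<notin> M \<and> separates Z x y \<and> separates (snd (f j)) x y"
    using minimal_packing[OF S M] by blast
  have small: "card (snd (f i)) \<le> 1" if i: "i < af S M" for i
  proof (rule ccontr)
    assume "\<not> card (snd (f i)) \<le> 1"
    then have big: "1 < card (snd (f i))" by simp
    have "\<exists>M'. perfect_matching (HV S) (HE S) M' \<and> af S M + 2 \<le> af S M'"
      by (rule nonsingleton_improvement[of S M f i]) (fact S M i big cl lam dis min)+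
    then obtain M' where M': "perfect_matching (HV S) (HE S) M'" "af S M + 2 \<le> af S M'" by blast
    then show False using af_le_Af[OF S M'(1)] assms(3) by linarith
  qed
  have "\<exists>c. snd (f i) = {c}" if "i < af S M" for i
  proof -
    have "finite (snd (f i))" "snd (f i) \<noteq> {}"
      using cl[OF that] S(2) finite_subset unfolding dicut_side_def by blast+
    then have "card (snd (f i)) = 1" using small[OF that] by (metis card_gt_0_iff le_antisym Suc_leI One_nat_def)
    then show ?thesis by (rule card_1_singletonE) blast
  qed
  then obtain c where c: "\<And>i. i < af S M \<Longrightarrow> snd (f i) = {c i}" by metis
  let ?C = "{c. \<exists>\<sigma>. dicut_side S M \<sigma> {c}}"
  have fin: "finite ?C" by (rule finite_subset[OF _ S(2)]) (auto simp: dicut_side_def)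
  have "inj_on c {..<af S M}"
  proof (rule inj_onI, rule ccontr)
    fix i j assume ij: "i \<in> {..<af S M}" "j \<in> {..<af S M}" "c i = c j" "i \<noteq> j"
    then have eq: "snd (f i) = snd (f j)" using c by simp
    have "snd (f i) \<subseteq> S" "snd (f i) \<noteq> {}" using cl[of i] ij(1) by (auto simp: dicut_side_def)
    then obtain x y where "dual_arc x y" "separates (snd (f i)) x y" "shared_edge x y \<notin> M" using ex_cut_arc[OF S(1,2) M] by blast
    then show False using dis[of i j x y] ij eq by simp
  qed
  \<comment> \<open>Every member is now an alternating hexagon, which bounds \<open>af\<close> by
    \<open>fr\<close>; the converse inequality holds for every perfect matching.\<close>
  moreover have "c ` {..<af S M} \<subseteq> ?C"
  proof (rule image_subsetI)
    fix i assume "i \<in> {..<af S M}"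
    then show "c i \<in> ?C" using cl[of i] c[of i] by auto
  qed
  ultimately have "af S M \<le> card ?C" using card_inj_on_le[OF _ _ fin] by fastforce
  then have "af S M \<le> fr S M" using fr_eq_card[OF S(1) M] by simp
  then show ?thesis using fr_le_af[OF S M] by simp
qed

end
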